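(* Let $n\ge3$. Then $W_{B_n^{(1)}}\cdot\varnothing=\mathcal C_{2n}^{s,p}$; that is, the affine Grassmannian elements of type $B_n^{(1)}$ are parametrized by the self-conjugate $2n$-cores with an even diagonal.
   Context: A $2n$-core is a partition having no hook length equal to $2n$; $\mathcal C_{2n}$ is the set of $2n$-cores, $\mathcal C_{2n}^s$ the subset of self-conjugate ones, and $\mathcal C_{2n}^{s,p}$ the subset of $\mathcal C_{2n}^s$ of cores having an even number of boxes on the main diagonal (boxes of content $0$). The box in row $i$, column $j$ has content $j-i$ and residue $(j-i)\bmod 2n$; boxes of residue $i$ are $i$-nodes. The affine Weyl group $\widetilde{\mathfrak S}_{2n}$ of type $A_{2n-1}^{(1)}$, with simple reflections $s_0,\dots,s_{2n-1}$, acts on $\mathcal C_{2n}$: $s_i\cdot c$ is obtained by removing all removable $i$-nodes of $c$ if there are some, adding all addable $i$-nodes if there are some, and $s_i\cdot c=c$ otherwise. The affine Weyl group $W_{B_n^{(1)}}$ is realized as the subgroup of $\widetilde{\mathfrak S}_{2n}$ generated by $s_0^{B_n^{(1)}}=s_0s_1s_{2n-1}s_0$, $s_i^{B_n^{(1)}}=s_is_{2n-i}$ ($1\le i\le n-1$) and $s_n^{B_n^{(1)}}=s_n$. Its affine Grassmannian elements are the minimal length representatives of the left cosets modulo the finite Weyl group generated by $s_1^{B_n^{(1)}},\dots,s_n^{B_n^{(1)}}$; they are parametrized by cores through $w\mapsto w\cdot\varnothing$. *)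

theory Defs
  imports "HOL-Algebra.Algebra"
begin

section \<open>Partitions and cores\<close>

text \<open>
  A partition is identified with its Young diagram: a finite set of boxes \<open>(i, j)\<close>
  (row \<open>i\<close>, column \<open>j\<close>, both numbered from 1) that contains, together with \<open>(i, j)\<close>,
  every box weakly above and weakly to the left of it.
\<close>

type_synonym diagram = "(nat \<times> nat) set"

definition young_diagram :: "diagram \<Rightarrow> bool" where
  "young_diagram D \<longleftrightarrow> finite D \<and>
     (\<forall>(i, j) \<in> D. 1 \<le> i \<and> 1 \<le> j \<and> {1..i} \<times> {1..j} \<subseteq> D)"

definition conjugate :: "diagram \<Rightarrow> diagram" where
  "conjugate D = {(j, i) | i j. (i, j) \<in> D}"

text \<open>Arm length plus leg length plus one.\<close>

definition hook_length :: "diagram \<Rightarrow> nat \<times> nat \<Rightarrow> nat" where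
  "hook_length D = (\<lambda>(i, j). card {j'. j < j' \<and> (i, j') \<in> D} + card {i'. i < i' \<and> (i', j) \<in> D} + 1)"

definition cores :: "nat \<Rightarrow> diagram set" where
  "cores N = {D. young_diagram D \<and> (\<forall>b \<in> D. hook_length D b \<noteq> N)}"

definition content :: "nat \<times> nat \<Rightarrow> int" where
  "content = (\<lambda>(i, j). int j - int i)"

definition residue :: "nat \<Rightarrow> nat \<times> nat \<Rightarrow> int" where
  "residue N b = content b mod int N"

definition sc_cores :: "nat \<Rightarrow> diagram set" where
  "sc_cores N = {D \<in> cores N. conjugate D = D}"

definition sc_even_cores :: "nat \<Rightarrow> diagram set" where
  "sc_even_cores N = {D \<in> sc_cores N. even (card {b \<in> D. content b = 0})}"

definition removable_nodes :: "nat \<Rightarrow> nat \<Rightarrow> diagram \<Rightarrow> diagram" where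
  "removable_nodes N i D = {b \<in> D. residue N b = int i \<and> young_diagram (D - {b})}"

definition addable_nodes :: "nat \<Rightarrow> nat \<Rightarrow> diagram \<Rightarrow> diagram" where
  "addable_nodes N i D = {b. b \<notin> D \<and> residue N b = int i \<and> young_diagram (insert b D)}"

text \<open>The action of the simple reflection \<open>s\<^sub>i\<close>, \<open>i < N\<close>, on an \<open>N\<close>-core.\<close>

definition core_reflection :: "nat \<Rightarrow> nat \<Rightarrow> diagram \<Rightarrow> diagram" where
  "core_reflection N i D =
     (if removable_nodes N i D \<noteq> {} then D - removable_nodes N i D
      else if addable_nodes N i D \<noteq> {} then D \<union> addable_nodes N i D
      else D)"


section \<open>The affine symmetric group\<close>

text \<open>
  The affine Weyl group of type \<open>A\<^sub>N\<^sub>-\<^sub>1\<close>, realized as the group of affine permutations: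
  the \<open>N\<close>-periodic bijections of the integers with window sum \<open>1 + \<dots> + N\<close>.
  The simple reflection \<open>s\<^sub>i\<close> exchanges \<open>i + k N\<close> and \<open>i + 1 + k N\<close> for all integers \<open>k\<close>.
\<close>

definition affine_sym :: "nat \<Rightarrow> (int \<Rightarrow> int) monoid" where
  "affine_sym N =
     \<lparr> carrier = {w. bij w \<and> (\<forall>k. w (k + int N) = w k + int N)
                       \<and> (\<Sum>k = 1..int N. w k) = (\<Sum>k = 1..int N. k)},
       monoid.mult = (\<circ>),
       one = id \<rparr>"

definition simple_refl :: "nat \<Rightarrow> nat \<Rightarrow> int \<Rightarrow> int" where
  "simple_refl N i k =
     (if k mod int N = int i mod int N then k + 1
      else if k mod int N = (int i + 1) mod int N then k - 1
      else k)"

text \<open>The product \<open>s i\<^sub>1 \<circ> \<dots> \<circ> s i\<^sub>r\<close> for a word \<open>[i\<^sub>1, \<dots>, i\<^sub>r]\<close>.\<close>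

definition word_prod :: "(nat \<Rightarrow> 'a \<Rightarrow> 'a) \<Rightarrow> nat list \<Rightarrow> 'a \<Rightarrow> 'a" where
  "word_prod s is = foldr (\<lambda>i v. s i \<circ> v) is id"

text \<open>
  The action of the affine symmetric group on \<open>N\<close>-cores extending that of the simple
  reflections: \<open>w \<cdot> c\<close> is the common value of
  \<open>s\<^bsub>i\<^sub>1\<^esub> \<cdot> (\<dots> (s\<^bsub>i\<^sub>r\<^esub> \<cdot> c))\<close> over all words with \<open>w = s\<^bsub>i\<^sub>1\<^esub> \<dots> s\<^bsub>i\<^sub>r\<^esub>\<close>.
\<close>

definition core_action :: "nat \<Rightarrow> (int \<Rightarrow> int) \<Rightarrow> diagram \<Rightarrow> diagram" where
  "core_action N w c =
     (THE d. \<exists>is. set is \<subseteq> {..<N} \<and> w = word_prod (simple_refl N) is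
                  \<and> d = word_prod (core_reflection N) is c)"


section \<open>The affine Weyl group of type \<open>B\<^sub>n\<close> inside the affine symmetric group\<close>

definition simple_refl_B :: "nat \<Rightarrow> nat \<Rightarrow> int \<Rightarrow> int" where
  "simple_refl_B n i =
     (if i = 0 then word_prod (simple_refl (2*n)) [0, 1, 2*n - 1, 0]
      else if i < n then word_prod (simple_refl (2*n)) [i, 2*n - i]
      else simple_refl (2*n) n)"

definition weyl_B_affine :: "nat \<Rightarrow> (int \<Rightarrow> int) set" where
  "weyl_B_affine n = generate (affine_sym (2*n)) (simple_refl_B n ` {0..n})"

definition weyl_B_finite :: "nat \<Rightarrow> (int \<Rightarrow> int) set" where
  "weyl_B_finite n = generate (affine_sym (2*n)) (simple_refl_B n ` {1..n})"

text \<open>Length with respect to the generators of type \<open>B\<close>, not those of the ambient type \<open>A\<close>.\<close>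

definition length_B :: "nat \<Rightarrow> (int \<Rightarrow> int) \<Rightarrow> nat" where
  "length_B n w =
     (LEAST l. \<exists>is. length is = l \<and> set is \<subseteq> {0..n} \<and> w = word_prod (simple_refl_B n) is)"

definition affine_grassmannian_B :: "nat \<Rightarrow> (int \<Rightarrow> int) set" where
  "affine_grassmannian_B n =
     {w \<in> weyl_B_affine n.
        \<forall>u \<in> w <#\<^bsub>affine_sym (2*n)\<^esub> weyl_B_finite n. length_B n w \<le> length_B n u}"

end

theory Submission
  imports Defs
begin

text \<open>
Record a partition \<open>\<lambda>\<close> by its set of beads \<open>B = {\<lambda>\<^sub>r - r + 1 | r \<ge> 1}\<close>; the empty partition
becomes \<open>{..0}\<close>. Adding a box of content \<open>c\<close> moves a bead from \<open>c\<close> to \<open>c + 1\<close>, and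
\<^item> \<open>B\<close> determines the partition (\<open>beads_inject\<close>);
\<^item> hook lengths are the differences of a bead and a smaller gap, so \<open>\<lambda>\<close> is an \<open>N\<close>-core iff
  \<open>B - N \<subseteq> B\<close> (\<open>cores_iff\<close>);
\<^item> conjugation replaces \<open>B\<close> by \<open>{1 - k | k \<notin> B}\<close> (\<open>beads_conjugate\<close>), and the boxes of content 0
  correspond to the positive beads (\<open>card_diagonal\<close>);
\<^item> on cores, the reflection with index \<open>i\<close> is the image of \<open>B\<close> under the affine permutation \<open>s\<^sub>i\<close>
  (\<open>core_reflection_beads\<close>).

Hence \<open>w \<cdot> \<emptyset>\<close> is the core with bead set \<open>w ` {..0}\<close>, and the theorem becomes a statement about the
orbit and the fibres of \<open>w \<mapsto> w ` {..0}\<close>. The generators \<open>t\<^sub>i\<close> of type B are affine permutations that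
commute with \<open>k \<mapsto> 1 - k\<close>: each exchanges two integers \<open>x, y\<close>, and simultaneously \<open>1 - x, 1 - y\<close>,
modulo \<open>2n\<close>. The pairs are \<open>(i, i + 1)\<close> for \<open>1 \<le> i \<le> n\<close> and \<open>(0, 2)\<close> for the index 0.

The orbit. The bead set of \<open>w \<cdot> \<emptyset>\<close> is symmetric, so the core is self-conjugate. The
generators with index at least 1 keep the number of positive beads, and the one with index 0
changes it by an even number (\<open>parity_step\<close>). Conversely, a nonempty self-conjugate core has a
removable box of residue \<open>i \<le> n\<close> together with its mirror image, so it gets smaller under \<open>s\<^sub>0\<close> or under
a generator of index \<open>i \<ge> 1\<close> (\<open>generator_removal\<close>). Conjugation by \<open>s\<^sub>0\<close> permutes the generators of
type B, so all occurrences of \<open>s\<^sub>0\<close> can be collected and cancelled up to at most one, next to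
\<open>{..0}\<close>. A remaining \<open>s\<^sub>0\<close> would make the number of positive beads odd (\<open>even_core_reached\<close>).

The minimal representatives. The group satisfies an exchange condition (\<open>exchange\<close>): if
\<open>1 \<le> i \<le> n\<close> and \<open>w (i + 1) < w i\<close>, then one letter can be deleted from any word of \<open>w\<close> to get a
word of \<open>w \<circ> t\<^sub>i\<close>. So an element of minimal length in its coset is increasing on \<open>{1..2n}\<close>. The set
\<open>w ` {..0}\<close> determines \<open>w ` {1..2n}\<close>, hence an increasing \<open>w\<close> (\<open>affine_grassmannian_determined\<close>).
This gives injectivity; surjectivity holds because the finite group preserves \<open>{..0}\<close>, so that the
core does not change when \<open>w\<close> is replaced by a shortest element of its coset.
\<close>

section \<open>Young diagrams and their rows\<close>

lemma young_closed:
  assumes "young_diagram D" "(r, j) \<in> D" "1 \<le> r'" "r' \<le> r" "1 \<le> j'" "j' \<le> j"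
  shows "(r', j') \<in> D"
proof -
  have "{1..r} \<times> {1..j} \<subseteq> D" using assms(1,2) by (auto simp: young_diagram_def)
  then show ?thesis using assms(3-) by auto
qed

lemma young_pos:
  assumes "young_diagram D" "(r, j) \<in> D"
  shows "1 \<le> r" "1 \<le> j"
  using assms by (auto simp: young_diagram_def)

lemma youngI:
  assumes "finite D" "\<And>r j. (r, j) \<in> D \<Longrightarrow> 1 \<le> r \<and> 1 \<le> j"
    "\<And>r j r' j'. (r, j) \<in> D \<Longrightarrow> 1 \<le> r' \<Longrightarrow> r' \<le> r \<Longrightarrow> 1 \<le> j' \<Longrightarrow> j' \<le> j \<Longrightarrow> (r', j') \<in> D"
  shows "young_diagram D"
proof -
  have "1 \<le> r \<and> 1 \<le> j \<and> {1..r} \<times> {1..j} \<subseteq> D" if "(r, j) \<in> D" for r j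
    using assms(2)[OF that] assms(3)[OF that] by auto
  then show ?thesis unfolding young_diagram_def using assms(1) by blast
qed

lemma mem_conjugate [simp]: "(j, r) \<in> conjugate D \<longleftrightarrow> (r, j) \<in> D"
  by (auto simp: conjugate_def)

lemma young_conjugate:
  assumes "young_diagram D"
  shows "young_diagram (conjugate D)"
proof (rule youngI)
  have "conjugate D = prod.swap ` D" by (force simp: conjugate_def)
  moreover have "finite D" using assms by (simp add: young_diagram_def)
  ultimately show "finite (conjugate D)" by simp
next
  show "1 \<le> j \<and> 1 \<le> r" if "(j, r) \<in> conjugate D" for j r
    using that young_pos[OF assms, of r j] by simp
next
  show "(j', r') \<in> conjugate D"
    if "(j, r) \<in> conjugate D" "1 \<le> j'" "j' \<le> j" "1 \<le> r'" "r' \<le> r" for j r j' r'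
    using that young_closed[OF assms, of r j r' j'] by simp
qed

definition row_length :: "diagram \<Rightarrow> nat \<Rightarrow> nat" where
  "row_length D r = card {j. (r, j) \<in> D}"

lemma finite_row: "young_diagram D \<Longrightarrow> finite {j. (r, j) \<in> D}"
  by (rule finite_subset[of _ "snd ` D"]) (force simp: young_diagram_def)+

lemma mem_iff_row_length:
  assumes "young_diagram D"
  shows "(r, j) \<in> D \<longleftrightarrow> 1 \<le> r \<and> 1 \<le> j \<and> j \<le> row_length D r"
proof (cases "{j. (r, j) \<in> D} = {}")
  case True
  then show ?thesis by (auto simp: row_length_def)
next
  case False
  define m where "m = Max {j. (r, j) \<in> D}"
  have fin: "finite {j. (r, j) \<in> D}" using assms by (rule finite_row)
  have m: "(r, m) \<in> D" using Max_in[OF fin False] by (simp add: m_def)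
  have "{j. (r, j) \<in> D} = {1..m}"
  proof (intro Set.set_eqI iffI)
    fix j assume j: "j \<in> {j. (r, j) \<in> D}"
    then have "j \<le> m" using Max_ge[OF fin] by (simp add: m_def)
    then show "j \<in> {1..m}" using j young_pos[OF assms] by auto
  next
    fix j assume "j \<in> {1..m}"
    then show "j \<in> {j. (r, j) \<in> D}"
      using young_closed[OF assms m] young_pos[OF assms m] by auto
  qed
  moreover from this have "row_length D r = m" by (simp add: row_length_def)
  ultimately show ?thesis using young_pos[OF assms m] by auto
qed

lemma row_length_eqI:
  assumes "young_diagram D" "1 \<le> r" "\<And>j. 1 \<le> j \<Longrightarrow> (r, j) \<in> D \<longleftrightarrow> j \<le> m"
  shows "row_length D r = m"
proof -
  have "{j. (r, j) \<in> D} = {1..m}"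
    using assms(3) young_pos[OF assms(1)] by force
  then show ?thesis by (simp add: row_length_def)
qed

lemma row_length_antimono:
  assumes "young_diagram D" "1 \<le> r" "r \<le> s"
  shows "row_length D s \<le> row_length D r"
proof (cases "row_length D s = 0")
  case False
  then have "(s, row_length D s) \<in> D" using mem_iff_row_length[OF assms(1)] assms by auto
  then have "(r, row_length D s) \<in> D" using young_closed[OF assms(1)] assms False by auto
  then show ?thesis using mem_iff_row_length[OF assms(1)] by auto
qed simp

section \<open>Beads\<close>

definition bead :: "diagram \<Rightarrow> nat \<Rightarrow> int" where
  "bead D r = int (row_length D r) - int r + 1"

definition beads :: "diagram \<Rightarrow> int set" where
  "beads D = bead D ` {1..}"

lemma bead_strict_antimono:
  assumes "young_diagram D" "1 \<le> r" "r < s"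
  shows "bead D s < bead D r"
  using row_length_antimono[OF assms(1,2), of s] assms(3) by (simp add: bead_def)

lemma bead_less_iff:
  assumes "young_diagram D" "1 \<le> r" "1 \<le> s"
  shows "bead D s < bead D r \<longleftrightarrow> r < s"
  using bead_strict_antimono[OF assms(1)] assms(2,3) by (metis less_asym linorder_neqE_nat less_irrefl)

lemma inj_on_bead: "young_diagram D \<Longrightarrow> inj_on (bead D) {1..}"
  by (rule inj_onI) (metis atLeast_iff bead_less_iff less_irrefl linorder_neqE_nat)

lemma finite_beads_above:
  assumes "young_diagram D"
  shows "finite {b \<in> beads D. b > c}"
proof (rule finite_subset)
  show "{b \<in> beads D. b > c} \<subseteq> {c..bead D 1}"
    using bead_less_iff[OF assms] by (force simp: beads_def not_less[symmetric])
qed simp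

text \<open>
Beads decrease strictly with the row, and \<open>(r, j)\<close> is a box exactly when the bead of row \<open>r\<close>
exceeds \<open>j - r\<close>. This holds iff the first \<open>r\<close> beads all exceed \<open>j - r\<close>, a condition that refers
only to the set of beads.
\<close>

lemma mem_iff_beads:
  assumes "young_diagram D"
  shows "(r, j) \<in> D \<longleftrightarrow> 1 \<le> r \<and> 1 \<le> j \<and> r \<le> card {b \<in> beads D. b > int j - int r}"
proof (cases "1 \<le> r \<and> 1 \<le> j")
  case False
  then show ?thesis using young_pos[OF assms] by blast
next
  case True
  let ?S = "{b \<in> beads D. b > int j - int r}"
  show ?thesis
  proof (cases "(r, j) \<in> D")
    case mem: True
    have "bead D ` {1..r} \<subseteq> ?S"
    proof
      fix b assume "b \<in> bead D ` {1..r}"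
      then obtain s where s: "1 \<le> s" "s \<le> r" "b = bead D s" by auto
      have "bead D r \<le> b" using bead_less_iff[OF assms, of r s] s True by (metis leD leI)
      moreover have "bead D r > int j - int r"
        using mem mem_iff_row_length[OF assms] by (auto simp: bead_def)
      ultimately show "b \<in> ?S" using s by (auto simp: beads_def)
    qed
    then have "card (bead D ` {1..r}) \<le> card ?S"
      by (rule card_mono[OF finite_beads_above[OF assms]])
    moreover have "card (bead D ` {1..r}) = r"
      using card_image[OF inj_on_subset[OF inj_on_bead[OF assms], of "{1..r}"]] by auto
    ultimately show ?thesis using mem True by simp
  next
    case mem: False
    have "bead D r \<le> int j - int r"
      using mem mem_iff_row_length[OF assms] True by (auto simp: bead_def)
    then have "?S \<subseteq> bead D ` {1..<r}"
      using bead_less_iff[OF assms] True by (force simp: beads_def)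
    then have "card ?S \<le> card (bead D ` {1..<r})" by (rule card_mono[rotated]) simp
    also have "\<dots> \<le> r - 1" using card_image_le[of "{1..<r}" "bead D"] by simp
    finally show ?thesis using mem True by linarith
  qed
qed

lemma beads_inject:
  assumes "young_diagram D" "young_diagram E" "beads D = beads E"
  shows "D = E"
  using mem_iff_beads[OF assms(1)] mem_iff_beads[OF assms(2)] assms(3) by auto

lemma young_empty [simp]: "young_diagram {}"
  by (simp add: young_diagram_def)

lemma beads_empty: "beads {} = {..0}"
proof -
  have "k \<in> beads {}" if "k \<le> 0" for k
    using that by (auto simp: beads_def bead_def row_length_def image_iff
      intro!: bexI[of _ "nat (1 - k)"])
  then show ?thesis by (auto simp: beads_def bead_def row_length_def)
qed

text \<open>
The boundary path of the diagram has one step at each integer: the vertical steps, at the ends of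
rows, are the beads, and the horizontal steps, at the ends of columns, are the gaps. The column of a
gap \<open>k\<close> ends just above the first row whose bead is at most \<open>k\<close>.
\<close>

lemma not_mem_beads_iff:
  assumes "young_diagram D"
  shows "k \<notin> beads D \<longleftrightarrow> (\<exists>j\<ge>1. k = int j - int (row_length (conjugate D) j))"
proof
  assume k: "k \<notin> beads D"
  define P where "P = (\<lambda>r. 1 \<le> r \<and> bead D r \<le> k)"
  \<comment> \<open>Beads tend to minus infinity: the length of row \<open>r\<close> is at most that of row 1.\<close>
  have "P (Suc (nat (int (row_length D 1) - k)))"
    using row_length_antimono[OF assms, of 1 "Suc (nat (int (row_length D 1) - k))"]
    by (auto simp: P_def bead_def)
  then have ex: "\<exists>r. P r" by blast
  define r where "r = (LEAST r. P r)"
  have "P r" unfolding r_def by (rule LeastI_ex[OF ex])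
  then have r: "1 \<le> r" "bead D r < k"
    using k by (auto simp: P_def beads_def less_le)
  have before: "k < bead D s" if "1 \<le> s" "s < r" for s
    using not_less_Least[of s P] that unfolding r_def[symmetric] by (auto simp: P_def)
  define j where "j = nat (k + int r - 1)"
  have j: "1 \<le> j" "int j = k + int r - 1" "row_length D r < j" using r by (auto simp: j_def bead_def)
  have "row_length (conjugate D) j = r - 1"
  proof (rule row_length_eqI[OF young_conjugate[OF assms] j(1)])
    fix s :: nat assume s: "1 \<le> s"
    show "(j, s) \<in> conjugate D \<longleftrightarrow> s \<le> r - 1"
    proof (cases "s < r")
      case True
      have "k < bead D (r - 1)" using before[of "r - 1"] True s by simp
      then have "j \<le> row_length D (r - 1)" using j r True s by (auto simp: bead_def of_nat_diff)
      also have "\<dots> \<le> row_length D s" using row_length_antimono[OF assms s] True by simp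
      finally show ?thesis using mem_iff_row_length[OF assms] j s True by auto
    next
      case False
      then have "row_length D s \<le> row_length D r" using row_length_antimono[OF assms r(1)] by simp
      then show ?thesis using mem_iff_row_length[OF assms] j False r by auto
    qed
  qed
  then show "\<exists>j\<ge>1. k = int j - int (row_length (conjugate D) j)"
    using j r by (intro exI[of _ j]) auto
next
  assume "\<exists>j\<ge>1. k = int j - int (row_length (conjugate D) j)"
  then obtain j where j: "1 \<le> j" "k = int j - int (row_length (conjugate D) j)" by blast
  show "k \<notin> beads D"
  proof
    assume "k \<in> beads D"
    then obtain r where r: "1 \<le> r" "k = bead D r" by (auto simp: beads_def)
    show False
      using j r mem_iff_row_length[OF assms, of r j]
        mem_iff_row_length[OF young_conjugate[OF assms], of j r]
      by (cases "(r, j) \<in> D") (auto simp: bead_def)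
  qed
qed

lemma beads_conjugate:
  assumes "young_diagram D"
  shows "k \<in> beads (conjugate D) \<longleftrightarrow> 1 - k \<notin> beads D"
proof -
  have "k \<in> beads (conjugate D) \<longleftrightarrow> (\<exists>j\<ge>1. k = bead (conjugate D) j)"
    by (auto simp: beads_def)
  also have "\<dots> \<longleftrightarrow> (\<exists>j\<ge>1. 1 - k = int j - int (row_length (conjugate D) j))"
    unfolding bead_def by (intro ex_cong1 conj_cong refl) linarith
  finally show ?thesis unfolding not_mem_beads_iff[OF assms] .
qed

text \<open>
For the bead set of a partition this is self-conjugacy: \<open>k \<mapsto> 1 - k\<close> exchanges beads and gaps.
\<close>

definition symmetric_set :: "int set \<Rightarrow> bool" where
  "symmetric_set B \<longleftrightarrow> (\<forall>k. k \<in> B \<longleftrightarrow> 1 - k \<notin> B)"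

lemma self_conjugate_iff:
  assumes "young_diagram D"
  shows "conjugate D = D \<longleftrightarrow> symmetric_set (beads D)"
proof
  assume "conjugate D = D"
  then show "symmetric_set (beads D)"
    using beads_conjugate[OF assms] unfolding symmetric_set_def by metis
next
  assume "symmetric_set (beads D)"
  then have "beads (conjugate D) = beads D"
    using beads_conjugate[OF assms] unfolding symmetric_set_def by blast
  then show "conjugate D = D" by (rule beads_inject[OF young_conjugate[OF assms] assms])
qed

text \<open>
The arm and the leg of a box end on the boundary path, at the bead of its row and at the gap of its
column.
\<close>

lemma hook_length_eq:
  assumes "young_diagram D" "(r, j) \<in> D"
  shows "int (hook_length D (r, j)) =
    bead D r - (int j - int (row_length (conjugate D) j))"
proof -
  have m: "(r', j') \<in> D \<longleftrightarrow> 1 \<le> r' \<and> 1 \<le> j' \<and> j' \<le> row_length D r'"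
    and m': "(r', j') \<in> D \<longleftrightarrow> 1 \<le> j' \<and> 1 \<le> r' \<and> r' \<le> row_length (conjugate D) j'" for r' j'
    using mem_iff_row_length[OF assms(1), of r' j']
      mem_iff_row_length[OF young_conjugate[OF assms(1)], of j' r'] by simp_all
  have pos: "1 \<le> r" "1 \<le> j" using young_pos[OF assms] by auto
  have "{j'. j < j' \<and> (r, j') \<in> D} = {j<..row_length D r}"
    using pos by (auto simp: m)
  moreover have "{r'. r < r' \<and> (r', j) \<in> D} = {r<..row_length (conjugate D) j}"
    using pos by (auto simp: m')
  moreover have "j \<le> row_length D r" "r \<le> row_length (conjugate D) j"
    using assms(2) m[of r j] m'[of r j] by blast+
  ultimately show ?thesis by (simp add: hook_length_def bead_def of_nat_diff)
qed

lemma cores_iff: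
  assumes "1 \<le> N"
  shows "D \<in> cores N \<longleftrightarrow> young_diagram D \<and> (\<forall>b\<in>beads D. b - int N \<in> beads D)"
proof (cases "young_diagram D")
  case Y: True
  have "(\<exists>x\<in>D. hook_length D x = N) \<longleftrightarrow> (\<exists>b\<in>beads D. b - int N \<notin> beads D)"
  proof
    assume "\<exists>x\<in>D. hook_length D x = N"
    then obtain r j where x: "(r, j) \<in> D" "hook_length D (r, j) = N" by auto
    have "bead D r \<in> beads D" using young_pos[OF Y x(1)] by (auto simp: beads_def)
    moreover have "bead D r - int N \<notin> beads D"
      unfolding not_mem_beads_iff[OF Y] using hook_length_eq[OF Y x(1)] x young_pos[OF Y x(1)]
      by (intro exI[of _ j]) linarith
    ultimately show "\<exists>b\<in>beads D. b - int N \<notin> beads D" by blast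
  next
    assume "\<exists>b\<in>beads D. b - int N \<notin> beads D"
    then obtain r j where x: "1 \<le> r" "1 \<le> j"
        "bead D r - int N = int j - int (row_length (conjugate D) j)"
      unfolding not_mem_beads_iff[OF Y] by (auto simp: beads_def)
    have mem: "(r, j) \<in> D"
    proof (rule ccontr)
      assume "(r, j) \<notin> D"
      then show False using x mem_iff_row_length[OF Y, of r j] assms
          mem_iff_row_length[OF young_conjugate[OF Y], of j r] by (auto simp: bead_def)
    qed
    have "hook_length D (r, j) = N" using hook_length_eq[OF Y mem] x by simp
    with mem show "\<exists>x\<in>D. hook_length D x = N" by blast
  qed
  then show ?thesis using Y by (auto simp: cores_def)
qed (simp add: cores_def)

lemma card_diagonal:
  assumes "young_diagram D"
  shows "card {b \<in> D. content b = 0} = card (beads D \<inter> {1..})"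
proof -
  have "beads D \<inter> {1..} = bead D ` {r. (r, r) \<in> D}"
    using mem_iff_row_length[OF assms] by (force simp: beads_def bead_def)
  moreover have "inj_on (bead D) {r. (r, r) \<in> D}"
    by (rule inj_on_subset[OF inj_on_bead[OF assms]]) (use young_pos[OF assms] in auto)
  moreover have "{b \<in> D. content b = 0} = (\<lambda>r. (r, r)) ` {r. (r, r) \<in> D}"
    by (auto simp: content_def)
  moreover have "inj_on (\<lambda>r. (r, r)) {r. (r, r) \<in> D}" by (simp add: inj_on_def)
  ultimately show ?thesis by (simp add: card_image)
qed

section \<open>Reflections of cores\<close>

text \<open>
Divisibility is easier to manipulate than equality of remainders: conditions for different
centres combine by subtraction.
\<close>

lemma simple_refl_alt:
  "simple_refl N i k =
     (if int N dvd k - int i then k + 1 else if int N dvd k - 1 - int i then k - 1 else k)"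
  unfolding simple_refl_def mod_eq_dvd_iff by (simp add: algebra_simps)

lemma bead_in_beads: "1 \<le> r \<Longrightarrow> bead D r \<in> beads D"
  by (simp add: beads_def)

lemma residue_eq_iff:
  assumes "i < N"
  shows "residue N b = int i \<longleftrightarrow> int N dvd content b - int i"
proof -
  have "int i mod int N = int i" using assms by simp
  then show ?thesis unfolding residue_def using mod_eq_dvd_iff[of "content b" "int N" "int i"] by simp
qed

text \<open>
Removing the last box of row \<open>r\<close> pushes its bead down by one, which is possible iff the target
position is a gap: a bead there could only be that of row \<open>r + 1\<close>, and would mean that the two
rows have equal length.
\<close>

lemma removable_corner_iff:
  assumes "young_diagram D"
  shows "(r, j) \<in> D \<and> young_diagram (D - {(r, j)}) \<longleftrightarrow>
    1 \<le> r \<and> j = row_length D r \<and> bead D r - 1 \<notin> beads D"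
proof
  note m = mem_iff_row_length[OF assms]
  assume L: "(r, j) \<in> D \<and> young_diagram (D - {(r, j)})"
  then have rj: "1 \<le> r" "1 \<le> j" "j \<le> row_length D r" using m by auto
  have "(r, Suc j) \<notin> D" "(Suc r, j) \<notin> D"
    using young_closed[of "D - {(r, j)}" r "Suc j" r j] L rj
      young_closed[of "D - {(r, j)}" "Suc r" j r j] by auto
  then have *: "j = row_length D r" "row_length D (Suc r) < j" using m rj by auto
  have "bead D r - 1 \<noteq> bead D s" if "1 \<le> s" for s
  proof (cases "s \<le> r")
    case True
    then show ?thesis using bead_less_iff[OF assms rj(1) that] by linarith
  next
    case False
    then have "row_length D s \<le> row_length D (Suc r)" by (intro row_length_antimono[OF assms]) auto
    then show ?thesis using * False by (auto simp: bead_def)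
  qed
  then have "bead D r - 1 \<notin> beads D" unfolding beads_def by auto
  then show "1 \<le> r \<and> j = row_length D r \<and> bead D r - 1 \<notin> beads D"
    by (intro conjI rj(1) *(1))
next
  note m = mem_iff_row_length[OF assms]
  assume R: "1 \<le> r \<and> j = row_length D r \<and> bead D r - 1 \<notin> beads D"
  then have "bead D (Suc r) \<noteq> bead D r - 1" using bead_in_beads[of "Suc r" D] by auto
  moreover have "row_length D (Suc r) \<le> row_length D r"
    using R by (intro row_length_antimono[OF assms]) auto
  ultimately have less: "row_length D (Suc r) < row_length D r" by (auto simp: bead_def)
  have mem: "(r, j) \<in> D" using less R m by auto
  have "young_diagram (D - {(r, j)})"
  proof (rule youngI)
    show "finite (D - {(r, j)})" using assms by (simp add: young_diagram_def)
    show "1 \<le> r' \<and> 1 \<le> j'" if "(r', j') \<in> D - {(r, j)}" for r' j'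
      using that young_pos[OF assms] by auto
    fix a b a' b'
    assume a: "(a, b) \<in> D - {(r, j)}" "1 \<le> a'" "a' \<le> a" "1 \<le> b'" "b' \<le> b"
    have "(a', b') \<in> D" using a young_closed[OF assms] by auto
    moreover have "(a', b') \<noteq> (r, j)"
    proof
      assume "(a', b') = (r, j)"
      then have "r \<le> a" "j \<le> b" using a by auto
      then consider "a = r" "j < b" | "Suc r \<le> a" using a by fastforce
      then show False
      proof cases
        case 1
        then show False using a m R by auto
      next
        case 2
        then have "row_length D a \<le> row_length D (Suc r)"
          by (intro row_length_antimono[OF assms]) auto
        then show False using a m R less \<open>j \<le> b\<close> by auto
      qed
    qed
    ultimately show "(a', b') \<in> D - {(r, j)}" by simp
  qed
  then show "(r, j) \<in> D \<and> young_diagram (D - {(r, j)})" using mem by simp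
qed

lemma addable_corner_iff:
  assumes "young_diagram D"
  shows "(r, j) \<notin> D \<and> young_diagram (insert (r, j) D) \<longleftrightarrow>
    1 \<le> r \<and> j = row_length D r + 1 \<and> bead D r + 1 \<notin> beads D"
proof
  note m = mem_iff_row_length[OF assms]
  assume L: "(r, j) \<notin> D \<and> young_diagram (insert (r, j) D)"
  then have pos: "1 \<le> r" "1 \<le> j" using young_pos[of "insert (r, j) D" r j] by auto
  have j: "j = row_length D r + 1"
  proof (rule ccontr)
    assume "j \<noteq> row_length D r + 1"
    then have "row_length D r + 1 < j" using L pos m by auto
    then have "(r, row_length D r + 1) \<in> insert (r, j) D"
      using young_closed[of "insert (r, j) D" r j r "row_length D r + 1"] L pos by auto
    then show False using m[of r "row_length D r + 1"] \<open>row_length D r + 1 < j\<close> by auto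
  qed
  have "bead D r + 1 \<noteq> bead D s" if s: "1 \<le> s" for s
  proof (cases "s < r")
    case True
    then have "(r - 1, j) \<in> insert (r, j) D"
      using young_closed[of "insert (r, j) D" r j "r - 1" j] L pos s by auto
    then have "(r - 1, j) \<in> D" using pos by auto
    then have "j \<le> row_length D (r - 1)" using m by auto
    also have "\<dots> \<le> row_length D s" using True s by (intro row_length_antimono[OF assms]) auto
    finally show ?thesis using j True by (auto simp: bead_def)
  next
    case False
    then show ?thesis using bead_less_iff[OF assms s pos(1)] by linarith
  qed
  then have "bead D r + 1 \<notin> beads D" unfolding beads_def by auto
  then show "1 \<le> r \<and> j = row_length D r + 1 \<and> bead D r + 1 \<notin> beads D"
    by (intro conjI pos(1) j)
next
  note m = mem_iff_row_length[OF assms]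
  assume R: "1 \<le> r \<and> j = row_length D r + 1 \<and> bead D r + 1 \<notin> beads D"
  have above: "row_length D r < row_length D s" if "1 \<le> s" "s < r" for s
  proof -
    have "bead D (r - 1) \<noteq> bead D r + 1" proof -
      have "1 \<le> r - 1" using that by linarith
      then show ?thesis using R bead_in_beads[of "r - 1" D] by auto
    qed
    moreover have "row_length D r \<le> row_length D (r - 1)"
      using that by (intro row_length_antimono[OF assms]) auto
    ultimately have "row_length D r < row_length D (r - 1)"
      using that by (auto simp: bead_def of_nat_diff)
    also have "\<dots> \<le> row_length D s" using that by (intro row_length_antimono[OF assms]) auto
    finally show ?thesis .
  qed
  have "young_diagram (insert (r, j) D)"
  proof (rule youngI)
    show "finite (insert (r, j) D)" using assms by (simp add: young_diagram_def)
    show "1 \<le> r' \<and> 1 \<le> j'" if "(r', j') \<in> insert (r, j) D" for r' j'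
      using that young_pos[OF assms] R by auto
    fix a b a' b'
    assume a: "(a, b) \<in> insert (r, j) D" "1 \<le> a'" "a' \<le> a" "1 \<le> b'" "b' \<le> b"
    show "(a', b') \<in> insert (r, j) D"
    proof (cases "(a, b) \<in> D")
      case True
      then show ?thesis using a young_closed[OF assms] by auto
    next
      case False
      then have ab: "a = r" "b = j" using a by auto
      show ?thesis
      proof (cases "a' = r")
        case True
        then show ?thesis using a ab m R by auto
      next
        case False
        then show ?thesis using a ab m R above[of a'] by auto
      qed
    qed
  qed
  moreover have "(r, j) \<notin> D" using R m by auto
  ultimately show "(r, j) \<notin> D \<and> young_diagram (insert (r, j) D)" by simp
qed

lemma removable_nodes_eq:
  assumes "young_diagram D" "i < N"
  shows "removable_nodes N i D = {(r, row_length D r) | r. 1 \<le> r \<and>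
     int N dvd bead D r - 1 - int i \<and> bead D r - 1 \<notin> beads D}"
proof -
  have "(r, j) \<in> removable_nodes N i D \<longleftrightarrow> int N dvd content (r, j) - int i \<and>
     1 \<le> r \<and> j = row_length D r \<and> bead D r - 1 \<notin> beads D" for r j
    using removable_corner_iff[OF assms(1), of r j]
    by (auto simp: removable_nodes_def residue_eq_iff[OF assms(2)])
  moreover have "content (r, row_length D r) = bead D r - 1" for r
    by (simp add: content_def bead_def)
  ultimately show ?thesis by auto
qed

lemma addable_nodes_eq:
  assumes "young_diagram D" "i < N"
  shows "addable_nodes N i D = {(r, row_length D r + 1) | r. 1 \<le> r \<and>
     int N dvd bead D r - int i \<and> bead D r + 1 \<notin> beads D}"
proof -
  have "(r, j) \<in> addable_nodes N i D \<longleftrightarrow> int N dvd content (r, j) - int i \<and>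
     1 \<le> r \<and> j = row_length D r + 1 \<and> bead D r + 1 \<notin> beads D" for r j
    using addable_corner_iff[OF assms(1), of r j]
    by (auto simp: addable_nodes_def residue_eq_iff[OF assms(2)])
  moreover have "content (r, row_length D r + 1) = bead D r" for r
    by (simp add: content_def bead_def)
  ultimately show ?thesis by auto
qed

text \<open>
Removable boxes can be removed simultaneously: no other box lies weakly below and to the right of a
removable one.
\<close>

lemma young_remove:
  assumes "young_diagram D"
  shows "young_diagram (D - removable_nodes N i D)"
proof (rule youngI)
  show "finite (D - removable_nodes N i D)" using assms by (simp add: young_diagram_def)
  show "1 \<le> r \<and> 1 \<le> j" if "(r, j) \<in> D - removable_nodes N i D" for r j
    using that young_pos[OF assms] by auto
  fix r j r' j'
  assume a: "(r, j) \<in> D - removable_nodes N i D" "1 \<le> r'" "r' \<le> r" "1 \<le> j'" "j' \<le> j"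
  have "(r', j') \<notin> removable_nodes N i D"
  proof
    assume R: "(r', j') \<in> removable_nodes N i D"
    then have "(r, j) \<in> D - {(r', j')}" using a by auto
    moreover have "young_diagram (D - {(r', j')})" using R by (simp add: removable_nodes_def)
    ultimately have "(r', j') \<in> D - {(r', j')}" using a young_closed by blast
    then show False by simp
  qed
  then show "(r', j') \<in> D - removable_nodes N i D" using a young_closed[OF assms] by auto
qed

text \<open>
Every addable box is in the first row or directly below a box.
\<close>

lemma finite_addable:
  assumes "young_diagram D"
  shows "finite (addable_nodes N i D)"
proof (rule finite_subset)
  let ?T = "insert (1, row_length D 1 + 1) ((\<lambda>(r, j). (Suc r, j)) ` D)"
  show "finite ?T" using assms by (simp add: young_diagram_def)
  show "addable_nodes N i D \<subseteq> ?T"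
  proof
    fix x assume x: "x \<in> addable_nodes N i D"
    obtain r j where rj: "x = (r, j)" by (cases x)
    have Y: "(r, j) \<notin> D" "young_diagram (insert (r, j) D)"
      using x rj by (auto simp: addable_nodes_def)
    then have "1 \<le> r" "j = row_length D r + 1" using addable_corner_iff[OF assms] by blast+
    moreover have "(r - 1, j) \<in> D" if "1 < r"
      proof -
      have "(r - 1, j) \<in> insert (r, j) D"
        using that young_pos[OF Y(2), of r j] by (intro young_closed[OF Y(2), of r j "r - 1" j]) auto
      then show ?thesis using that by auto
    qed
    ultimately show "x \<in> ?T" unfolding rj by (cases "r = 1") (force simp: image_iff)+
  qed
qed

lemma young_add:
  assumes "young_diagram D" "finite (addable_nodes N i D)"
  shows "young_diagram (D \<union> addable_nodes N i D)"
proof (rule youngI)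
  show "finite (D \<union> addable_nodes N i D)" using assms by (simp add: young_diagram_def)
  have *: "(r, j) \<in> insert (r, j) D \<and> young_diagram (insert (r, j) D) \<and> insert (r, j) D \<subseteq> D \<union> addable_nodes N i D"
    if "(r, j) \<in> D \<union> addable_nodes N i D" for r j
    using that assms(1) by (auto simp: addable_nodes_def insert_absorb)
  show "1 \<le> r \<and> 1 \<le> j" if "(r, j) \<in> D \<union> addable_nodes N i D" for r j
    using *[OF that] young_pos by blast
  show "(r', j') \<in> D \<union> addable_nodes N i D"
    if "(r, j) \<in> D \<union> addable_nodes N i D" "1 \<le> r'" "r' \<le> r" "1 \<le> j'" "j' \<le> j" for r j r' j'
    using *[OF that(1)] that(2-) young_closed by blast
qed

text \<open>
In the bead set of a core, the beads in a fixed residue class form an initial segment of the class.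
\<close>

lemma shift_closed:
  fixes b c :: int
  assumes "\<forall>b\<in>B. b - int N \<in> B" "b \<in> B" "int N dvd b - c" "c \<le> b" "1 \<le> N"
  shows "c \<in> B"
proof -
  obtain q where q: "b - c = int N * q" using assms(3) by blast
  have "q \<ge> 0" using q assms(4,5) by (metis diff_ge_0_iff_ge int_one_le_iff_zero_less of_nat_1 of_nat_le_iff zero_le_mult_iff not_less)
  then obtain m where m: "q = int m" using zero_le_imp_eq_int by blast
  have "b - int N * int m \<in> B" for m
  proof (induction m)
    case (Suc m)
    then have "b - int N * int m - int N \<in> B" using assms(1) by blast
    then show ?case by (simp add: algebra_simps)
  qed (simp add: assms(2))
  from this[of m] show ?thesis using q m by (simp add: algebra_simps)
qed

lemma simple_refl_image:
  assumes "2 \<le> N"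
  shows "k \<in> simple_refl N i ` B \<longleftrightarrow> simple_refl N i k \<in> B"
proof -
  have nd: "\<not> int N dvd 1" using assms by (auto dest: zdvd_imp_le)
  have inv: "simple_refl N i (simple_refl N i k) = k" for k
  proof -
    have *: "int N dvd k - 1 - int i \<Longrightarrow> \<not> int N dvd k - int i"
      using nd dvd_diff[of "int N" "k - int i" "k - 1 - int i"] by auto
    have "int N dvd k - int i \<Longrightarrow> \<not> int N dvd k + 1 - int i"
      using nd dvd_diff[of "int N" "k + 1 - int i" "k - int i"] by auto
    then show ?thesis using * by (auto simp: simple_refl_alt)
  qed
  then show ?thesis by (metis (no_types, lifting) imageE imageI)
qed

text \<open>
For a core, the beads congruent to \<open>i\<close> and those congruent to \<open>i + 1\<close> form initial segments of
their classes. One removable node shows that the second segment is the longer one, so that every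
bead \<open>b \<equiv> i\<close> has the bead \<open>b + 1\<close> beside it. Exchanging the two classes thus has the same effect as
moving just those beads that have a gap to their left.
\<close>

lemma beads_removal:
  assumes D: "D \<in> cores N" and N: "2 \<le> N" and i: "i < N" and ne: "removable_nodes N i D \<noteq> {}"
  shows "beads (D - removable_nodes N i D) = simple_refl N i ` beads D"
proof -
  have Y: "young_diagram D" and C: "\<forall>b\<in>beads D. b - int N \<in> beads D"
    using D cores_iff[of N D] N by auto
  define P where "P = (\<lambda>k. int N dvd k - int i)"
  define E where "E = D - removable_nodes N i D"
  define S where "S = (\<lambda>b. if P (b - 1) \<and> b - 1 \<notin> beads D then b - 1 else b)"
  obtain c where c: "P c" "c + 1 \<in> beads D" "c \<notin> beads D"
    using ne unfolding removable_nodes_eq[OF Y i] P_def beads_def by force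
  have full: "b + 1 \<in> beads D" if "b \<in> beads D" "P b" for b
  proof -
    have d: "int N dvd b - c" using that(2) c(1) dvd_diff[of "int N" "b - int i" "c - int i"]
      by (simp add: P_def)
    then have "b < c" using shift_closed[OF C that(1) d] c(3) N by linarith
    moreover have "int N dvd (c + 1) - (b + 1)" using d by (simp add: dvd_diff_commute)
    ultimately show ?thesis using shift_closed[OF C c(2), of "b + 1"] N by simp
  qed
  have "row_length E r = (if P (bead D r - 1) \<and> bead D r - 1 \<notin> beads D then row_length D r - 1 else row_length D r)"
    if r: "1 \<le> r" for r
  proof (rule row_length_eqI)
    show "young_diagram E" unfolding E_def by (rule young_remove[OF Y])
    show "1 \<le> r" by fact
    fix j :: nat assume j: "1 \<le> j"
    have "(r, j) \<in> E \<longleftrightarrow> j \<le> row_length D r \<and>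
        \<not> (j = row_length D r \<and> P (bead D r - 1) \<and> bead D r - 1 \<notin> beads D)"
      unfolding E_def removable_nodes_eq[OF Y i] P_def using mem_iff_row_length[OF Y, of r j] r j by auto
    then show "(r, j) \<in> E \<longleftrightarrow> j \<le> (if P (bead D r - 1) \<and> bead D r - 1 \<notin> beads D then row_length D r - 1 else row_length D r)"
      using j by auto
  qed
  moreover have "1 \<le> row_length D r" if r: "1 \<le> r" "bead D r - 1 \<notin> beads D" for r
    using removable_corner_iff[OF Y, of r "row_length D r"] r mem_iff_row_length[OF Y] by blast
  ultimately have "bead E r = S (bead D r)" if "1 \<le> r" for r
    using that by (auto simp: bead_def S_def of_nat_diff)
  then have "beads E = S ` beads D" by (force simp: beads_def image_iff)
  also have "\<dots> = simple_refl N i ` beads D"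
  proof (intro Set.set_eqI)
    fix k
    have nd: "\<not> int N dvd 1" using N by (auto dest: zdvd_imp_le)
    have P1: "P k \<Longrightarrow> \<not> P (k + 1)" for k
      using nd dvd_diff[of "int N" "k + 1 - int i" "k - int i"] by (auto simp: P_def)
    have "k \<in> S ` beads D \<longleftrightarrow> (k \<in> beads D \<and> \<not> (P (k - 1) \<and> k - 1 \<notin> beads D)) \<or>
       (k + 1 \<in> beads D \<and> P k \<and> k \<notin> beads D)"
    proof -
      have "k \<in> S ` beads D \<longleftrightarrow> (\<exists>b\<in>beads D. b = k \<and> \<not> (P (k - 1) \<and> k - 1 \<notin> beads D)) \<or>
         (\<exists>b\<in>beads D. b = k + 1 \<and> P k \<and> k \<notin> beads D)"
        unfolding image_iff bex_disj_distrib[symmetric]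
        by (intro bex_cong refl) (auto simp: S_def)
      then show ?thesis by blast
    qed
    also have "\<dots> \<longleftrightarrow> (if P k then k + 1 \<in> beads D else if P (k - 1) then k - 1 \<in> beads D else k \<in> beads D)"
      using full[of k] full[of "k - 1"] P1[of "k - 1"] by auto
    also have "\<dots> \<longleftrightarrow> simple_refl N i k \<in> beads D"
      by (auto simp: simple_refl_alt P_def)
    finally show "k \<in> S ` beads D \<longleftrightarrow> k \<in> simple_refl N i ` beads D"
      unfolding simple_refl_image[OF N] .
  qed
  finally show ?thesis unfolding E_def .
qed

lemma beads_addition:
  assumes D: "D \<in> cores N" and N: "2 \<le> N" and i: "i < N" and ne: "addable_nodes N i D \<noteq> {}"
  shows "young_diagram (D \<union> addable_nodes N i D) \<and>
     beads (D \<union> addable_nodes N i D) = simple_refl N i ` beads D"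
proof -
  have Y: "young_diagram D" and C: "\<forall>b\<in>beads D. b - int N \<in> beads D"
    using D cores_iff[of N D] N by auto
  define P where "P = (\<lambda>k. int N dvd k - int i)"
  define E where "E = D \<union> addable_nodes N i D"
  define S where "S = (\<lambda>b. if P b \<and> b + 1 \<notin> beads D then b + 1 else b)"
  obtain c where c: "P c" "c \<in> beads D" "c + 1 \<notin> beads D"
    using ne unfolding addable_nodes_eq[OF Y i] P_def beads_def by force
  have full: "b \<in> beads D" if "b + 1 \<in> beads D" "P b" for b
  proof -
    have d: "int N dvd (b + 1) - (c + 1)" using that(2) c(1) dvd_diff[of "int N" "b - int i" "c - int i"]
      by (simp add: P_def)
    then have "b < c" using shift_closed[OF C that(1) d] c(3) N by linarith
    moreover have "int N dvd c - b" using d by (simp add: dvd_diff_commute)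
    ultimately show ?thesis using shift_closed[OF C c(2), of b] N by simp
  qed
  note fin = finite_addable[OF Y]
  have YE: "young_diagram E" unfolding E_def by (rule young_add[OF Y fin])
  have "row_length E r = (if P (bead D r) \<and> bead D r + 1 \<notin> beads D then row_length D r + 1 else row_length D r)"
    if r: "1 \<le> r" for r
  proof (rule row_length_eqI[OF YE r])
    fix j :: nat assume j: "1 \<le> j"
    have "(r, j) \<in> E \<longleftrightarrow> j \<le> row_length D r \<or>
        (j = row_length D r + 1 \<and> P (bead D r) \<and> bead D r + 1 \<notin> beads D)"
      unfolding E_def addable_nodes_eq[OF Y i] P_def using mem_iff_row_length[OF Y, of r j] r j by auto
    then show "(r, j) \<in> E \<longleftrightarrow> j \<le> (if P (bead D r) \<and> bead D r + 1 \<notin> beads D then row_length D r + 1 else row_length D r)"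
      by auto
  qed
  then have "bead E r = S (bead D r)" if "1 \<le> r" for r
    using that by (auto simp: bead_def S_def)
  then have "beads E = S ` beads D" by (force simp: beads_def image_iff)
  also have "\<dots> = simple_refl N i ` beads D"
  proof (intro Set.set_eqI)
    fix k
    have nd: "\<not> int N dvd 1" using N by (auto dest: zdvd_imp_le)
    have P1: "P k \<Longrightarrow> \<not> P (k + 1)" for k
      using nd dvd_diff[of "int N" "k + 1 - int i" "k - int i"] by (auto simp: P_def)
    have "k \<in> S ` beads D \<longleftrightarrow> (k \<in> beads D \<and> \<not> (P k \<and> k + 1 \<notin> beads D)) \<or>
       (k - 1 \<in> beads D \<and> P (k - 1) \<and> k \<notin> beads D)"
    proof -
      have "k \<in> S ` beads D \<longleftrightarrow> (\<exists>b\<in>beads D. b = k \<and> \<not> (P k \<and> k + 1 \<notin> beads D)) \<or>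
         (\<exists>b\<in>beads D. b = k - 1 \<and> P (k - 1) \<and> k \<notin> beads D)"
        unfolding image_iff bex_disj_distrib[symmetric]
        by (intro bex_cong refl) (auto simp: S_def)
      then show ?thesis by blast
    qed
    also have "\<dots> \<longleftrightarrow> (if P k then k + 1 \<in> beads D else if P (k - 1) then k - 1 \<in> beads D else k \<in> beads D)"
      using full[of k] full[of "k - 1"] P1[of "k - 1"] by auto
    also have "\<dots> \<longleftrightarrow> simple_refl N i k \<in> beads D"
      by (auto simp: simple_refl_alt P_def)
    finally show "k \<in> S ` beads D \<longleftrightarrow> k \<in> simple_refl N i ` beads D"
      unfolding simple_refl_image[OF N] .
  qed
  finally show ?thesis using YE unfolding E_def by simp
qed


text \<open>
If there are neither removable nor addable nodes, then the two segments exchanged by the reflection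
have equal length and the bead set is invariant.
\<close>

lemma core_reflection_beads:
  assumes D: "D \<in> cores N" and N: "2 \<le> N" and i: "i < N"
  shows "core_reflection N i D \<in> cores N \<and>
     beads (core_reflection N i D) = simple_refl N i ` beads D"
proof -
  have Y: "young_diagram D" and C: "\<forall>b\<in>beads D. b - int N \<in> beads D"
    using D cores_iff[of N D] N by auto
  have *: "young_diagram (core_reflection N i D) \<and>
     beads (core_reflection N i D) = simple_refl N i ` beads D"
  proof (cases "removable_nodes N i D = {}")
    case False
    then show ?thesis
      using beads_removal[OF D N i] young_remove[OF Y] by (simp add: core_reflection_def)
  next
    case R: True
    show ?thesis
    proof (cases "addable_nodes N i D = {}")
      case False
      then show ?thesis using beads_addition[OF D N i] R by (simp add: core_reflection_def)
    next
      case A: True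
      have down: "k \<in> beads D" if "int N dvd k - int i" "k + 1 \<in> beads D" for k
      proof -
        from that(2) obtain r where r: "1 \<le> r" "k + 1 = bead D r" by (auto simp: beads_def)
        then have "k = bead D r - 1" by simp
        then show ?thesis using R r(1) that(1) unfolding removable_nodes_eq[OF Y i] by blast
      qed
      have up: "k + 1 \<in> beads D" if "int N dvd k - int i" "k \<in> beads D" for k
      proof -
        from that(2) obtain r where r: "1 \<le> r" "k = bead D r" by (auto simp: beads_def)
        then show ?thesis using A that(1) unfolding addable_nodes_eq[OF Y i] by blast
      qed
      have "k \<in> simple_refl N i ` beads D \<longleftrightarrow> k \<in> beads D" for k
      proof -
        have e: "k + 1 \<in> beads D \<longleftrightarrow> k \<in> beads D" if "int N dvd k - int i" for k
          using that down up by blast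
        show ?thesis
          unfolding simple_refl_image[OF N] simple_refl_alt using e[of k] e[of "k - 1"] by simp
      qed
      then have "simple_refl N i ` beads D = beads D" by blast
      then show ?thesis using R A Y by (simp add: core_reflection_def)
    qed
  qed
  have shift: "simple_refl N i (k - int N) = simple_refl N i k - int N" for k
  proof -
    have "(k - int N) mod int N = k mod int N" by simp
    then show ?thesis unfolding simple_refl_def by simp
  qed
  have "\<forall>b\<in>simple_refl N i ` beads D. b - int N \<in> simple_refl N i ` beads D"
  proof
    fix b assume "b \<in> simple_refl N i ` beads D"
    then obtain x where "x \<in> beads D" "b = simple_refl N i x" by blast
    then show "b - int N \<in> simple_refl N i ` beads D"
      using C shift[of x] by (intro image_eqI[of _ _ "x - int N"]) simp_all
  qed
  then show ?thesis using * cores_iff[of N "core_reflection N i D"] N by simp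
qed

lemma word_prod_Nil [simp]: "word_prod s [] = id"
  and word_prod_Cons [simp]: "word_prod s (i # is) = s i \<circ> word_prod s is"
  by (simp_all add: word_prod_def)

lemma word_prod_append: "word_prod s (is @ js) = word_prod s is \<circ> word_prod s js"
  by (induction "is") (simp_all add: comp_assoc)

lemma word_prod_core_reflection:
  assumes "set is \<subseteq> {..<N}" "2 \<le> N"
  shows "word_prod (core_reflection N) is {} \<in> cores N \<and>
     beads (word_prod (core_reflection N) is {}) = word_prod (simple_refl N) is ` {..0}"
  using assms(1)
proof (induction "is")
  case Nil
  then show ?case by (simp add: cores_def beads_empty)
next
  case (Cons i "is")
  then show ?case
    using core_reflection_beads[of "word_prod (core_reflection N) is {}" N i] assms(2)
    by (simp add: image_comp)
qed

text \<open>
The bead set of the result depends on the affine permutation only, not on the chosen word; this is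
why the action is well defined at the empty core.
\<close>

lemma core_action_empty:
  assumes "set is \<subseteq> {..<N}" "2 \<le> N" "w = word_prod (simple_refl N) is"
  shows "core_action N w {} \<in> cores N" "beads (core_action N w {}) = w ` {..0}"
proof -
  have "core_action N w {} = word_prod (core_reflection N) is {}"
    unfolding core_action_def
  proof (rule the_equality)
    show "\<exists>js. set js \<subseteq> {..<N} \<and> w = word_prod (simple_refl N) js \<and>
        word_prod (core_reflection N) is {} = word_prod (core_reflection N) js {}"
      using assms by blast
    fix d assume "\<exists>js. set js \<subseteq> {..<N} \<and> w = word_prod (simple_refl N) js \<and>
        d = word_prod (core_reflection N) js {}"
    then obtain js where js: "set js \<subseteq> {..<N}" "w = word_prod (simple_refl N) js"
        "d = word_prod (core_reflection N) js {}" by blast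
    show "d = word_prod (core_reflection N) is {}"
      using word_prod_core_reflection[OF js(1) assms(2)] word_prod_core_reflection[OF assms(1,2)]
        js assms(3) beads_inject by (auto simp: cores_def)
  qed
  then show "core_action N w {} \<in> cores N" "beads (core_action N w {}) = w ` {..0}"
    using word_prod_core_reflection[OF assms(1,2)] assms(3) by auto
qed

section \<open>Signed affine permutations\<close>

text \<open>
These are the elements of the affine Weyl group of type C, which contains the group of type B: the
affine permutations fixed by the diagram automorphism that exchanges \<open>s\<^sub>i\<close> and \<open>s\<^bsub>-i\<^esub>\<close>.
\<close>

definition signed_affine :: "nat \<Rightarrow> (int \<Rightarrow> int) \<Rightarrow> bool" where
  "signed_affine n w \<longleftrightarrow> bij w \<and> (\<forall>k. w (k + 2 * int n) = w k + 2 * int n) \<and> (\<forall>k. w (1 - k) = 1 - w k)"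

lemma signed_affine_inj: "signed_affine n w \<Longrightarrow> w a = w b \<longleftrightarrow> a = b"
  by (auto simp: signed_affine_def bij_def inj_eq)

lemma signed_affine_reflect: "signed_affine n w \<Longrightarrow> w (1 - k) = 1 - w k"
  by (simp add: signed_affine_def)

lemma signed_affine_shift:
  assumes "signed_affine n w"
  shows "w (k + 2 * int n * q) = w k + 2 * int n * q"
proof (induction q rule: int_induct[of _ 0])
  case (step1 q)
  then show ?case
    using assms[unfolded signed_affine_def, THEN conjunct2, THEN conjunct1, rule_format, of "k + 2 * int n * q"]
    by (simp add: algebra_simps)
next
  case (step2 q)
  then show ?case
    using assms[unfolded signed_affine_def, THEN conjunct2, THEN conjunct1, rule_format, of "k + 2 * int n * (q - 1)"]
    by (simp add: algebra_simps)
qed simp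

lemma signed_affine_dvd_iff:
  assumes "signed_affine n w"
  shows "2 * int n dvd w a - w b \<longleftrightarrow> 2 * int n dvd a - b"
proof
  assume "2 * int n dvd w a - w b"
  then obtain q where "w a - w b = 2 * int n * q" by (rule dvdE)
  then have "w a = w (b + 2 * int n * q)" using signed_affine_shift[OF assms] by simp
  then have "a = b + 2 * int n * q" by (simp only: signed_affine_inj[OF assms])
  then show "2 * int n dvd a - b" by simp
next
  assume "2 * int n dvd a - b"
  then obtain q where "a = b + 2 * int n * q" by (auto simp: dvd_def algebra_simps)
  then show "2 * int n dvd w a - w b" using signed_affine_shift[OF assms] by simp
qed

lemma signed_affine_id [simp]: "signed_affine n id"
  by (simp add: signed_affine_def)

lemma signed_affine_comp: "signed_affine n v \<Longrightarrow> signed_affine n w \<Longrightarrow> signed_affine n (v \<circ> w)"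
  by (simp add: signed_affine_def bij_comp)

text \<open>
The condition on the window sum is automatic: \<open>w k\<close> and \<open>w (2n + 1 - k)\<close> add up to \<open>2n + 1\<close>.
\<close>

lemma signed_affine_in_carrier:
  assumes "signed_affine n w"
  shows "w \<in> carrier (affine_sym (2 * n))"
proof -
  let ?M = "2 * int n"
  have "(\<Sum>k = 1..?M. f (?M + 1 - k)) = (\<Sum>k = 1..?M. f k)" for f :: "int \<Rightarrow> int"
    by (rule sum.reindex_bij_witness[of _ "\<lambda>k. ?M + 1 - k" "\<lambda>k. ?M + 1 - k"]) auto
  from this[of w] this[of "\<lambda>k. k"]
  have r: "(\<Sum>k = 1..?M. w (?M + 1 - k)) = (\<Sum>k = 1..?M. w k)"
    "(\<Sum>k = 1..?M. ?M + 1 - k) = (\<Sum>k = 1..?M. k)" .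
  have "w (?M + 1 - k) = ?M + 1 - w k" for k
    using signed_affine_shift[OF assms, of "1 - k" 1] signed_affine_reflect[OF assms, of k]
    by (simp add: algebra_simps)
  then have "(\<Sum>k = 1..?M. w k) = (\<Sum>k = 1..?M. k)"
    using r by (simp add: sum_subtractf)
  then show ?thesis using assms by (simp add: affine_sym_def signed_affine_def)
qed

text \<open>
The reflection that exchanges \<open>x\<close> with \<open>y\<close> and \<open>1 - x\<close> with \<open>1 - y\<close>, extended periodically. It is
total so that it can be used for images \<open>(w x, w y)\<close> without side conditions; it is a bijection
when \<open>x\<close> and \<open>y\<close> are incongruent modulo \<open>2n\<close>.
\<close>

definition signed_swap :: "nat \<Rightarrow> int \<Rightarrow> int \<Rightarrow> int \<Rightarrow> int" where
  "signed_swap n x y k =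
     (if 2 * int n dvd k - x \<or> 2 * int n dvd k - (1 - y) then k + (y - x)
      else if 2 * int n dvd k - y \<or> 2 * int n dvd k - (1 - x) then k - (y - x)
      else k)"

text \<open>
Conjugates of a reflection are the reflections in the images of its root; the congruences in the
definition are invariant under \<open>w\<close>.
\<close>

lemma signed_swap_conjugate:
  assumes "signed_affine n w"
  shows "w \<circ> signed_swap n x y = signed_swap n (w x) (w y) \<circ> w"
proof
  fix k
  have d: "2 * int n dvd w k - w a \<longleftrightarrow> 2 * int n dvd k - a"
    "2 * int n dvd w k - (1 - w a) \<longleftrightarrow> 2 * int n dvd k - (1 - a)" for a
    using signed_affine_dvd_iff[OF assms, of k a] signed_affine_dvd_iff[OF assms, of k "1 - a"]
    unfolding signed_affine_reflect[OF assms, of a] by blast+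
  have move: "w (k + (b - a)) = w k + (w b - w a)" if "2 * int n dvd k - a" for a b
  proof -
    from that obtain q where "k - a = 2 * int n * q" by (rule dvdE)
    then have k: "k = a + 2 * int n * q" "k + (b - a) = b + 2 * int n * q" by linarith+
    have "w k = w a + 2 * int n * q"
      by (subst k(1)) (rule signed_affine_shift[OF assms])
    moreover have "w (k + (b - a)) = w b + 2 * int n * q"
      by (subst k(2)) (rule signed_affine_shift[OF assms])
    ultimately show ?thesis by linarith
  qed
  have move': "w (k + (b - a)) = w k + (w b - w a)" if "2 * int n dvd k - (1 - b)" for a b
    using move[OF that, of "1 - a"] by (simp add: signed_affine_reflect[OF assms])
  have down: "w (k - (b - a)) = w k - (w b - w a)"
    if "2 * int n dvd k - b \<or> 2 * int n dvd k - (1 - a)" for a b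
  proof -
    have "w (k + (a - b)) = w k + (w a - w b)" using that move[of b a] move'[of a b] by blast
    then show ?thesis by (simp add: algebra_simps)
  qed
  have up: "w (k + (y - x)) = w k + (w y - w x)"
    if "2 * int n dvd k - x \<or> 2 * int n dvd k - (1 - y)"
    using that move[of x y] move'[of y x] by blast
  show "(w \<circ> signed_swap n x y) k = (signed_swap n (w x) (w y) \<circ> w) k"
    unfolding comp_apply signed_swap_def d using up down[of y x] by presburger
qed

lemma not_even_dvd_odd: "\<not> 2 * int n dvd 2 * a + 1" "\<not> 2 * int n dvd 2 * a - 1"
  by (metis dvd_trans dvd_triv_left even_plus_one_iff even_mult_iff even_numeral, metis dvd_trans dvd_triv_left odd_one even_diff even_add even_mult_iff even_numeral)

text \<open>
The upward and the downward case never meet: they would meet only if \<open>x \<equiv> y\<close>, or if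
\<open>x \<equiv> 1 - x\<close> or \<open>y \<equiv> 1 - y\<close>, which is excluded by parity since the period is even.
\<close>

lemma signed_swap_exclusive:
  assumes "\<not> 2 * int n dvd y - x" "2 * int n dvd k - x \<or> 2 * int n dvd k - (1 - y)"
  shows "\<not> (2 * int n dvd k - y \<or> 2 * int n dvd k - (1 - x))"
proof -
  have "\<not> (2 * int n dvd k - x \<and> 2 * int n dvd k - y)"
    using dvd_diff[of "2 * int n" "k - x" "k - y"] assms(1) by auto
  moreover have "\<not> (2 * int n dvd k - x \<and> 2 * int n dvd k - (1 - x))"
    using dvd_diff[of "2 * int n" "k - (1 - x)" "k - x"] not_even_dvd_odd(2)[of n x] by auto
  moreover have "\<not> (2 * int n dvd k - (1 - y) \<and> 2 * int n dvd k - y)"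
    using dvd_diff[of "2 * int n" "k - (1 - y)" "k - y"] not_even_dvd_odd(2)[of n y] by auto
  moreover have "\<not> (2 * int n dvd k - (1 - y) \<and> 2 * int n dvd k - (1 - x))"
    using dvd_diff[of "2 * int n" "k - (1 - y)" "k - (1 - x)"] assms(1) by auto
  ultimately show ?thesis using assms(2) by blast
qed

lemma signed_swap_involution:
  assumes "\<not> 2 * int n dvd y - x"
  shows "signed_swap n x y (signed_swap n x y k) = k"
proof -
  note ex = signed_swap_exclusive[OF assms]
  consider (p) "2 * int n dvd k - x \<or> 2 * int n dvd k - (1 - y)"
    | (m) "2 * int n dvd k - y \<or> 2 * int n dvd k - (1 - x)"
      "\<not> (2 * int n dvd k - x \<or> 2 * int n dvd k - (1 - y))"
    | (z) "\<not> (2 * int n dvd k - x \<or> 2 * int n dvd k - (1 - y))"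
      "\<not> (2 * int n dvd k - y \<or> 2 * int n dvd k - (1 - x))" by blast
  then show ?thesis
  proof cases
    case p
    have 1: "signed_swap n x y k = k + (y - x)" using p by (simp add: signed_swap_def)
    have 2: "2 * int n dvd k + (y - x) - y \<or> 2 * int n dvd k + (y - x) - (1 - x)"
      using p by (auto simp: algebra_simps)
    have 3: "\<not> (2 * int n dvd k + (y - x) - x \<or> 2 * int n dvd k + (y - x) - (1 - y))"
      using ex 2 by blast
    show ?thesis unfolding 1 using 2 3 by (auto simp: signed_swap_def)
  next
    case m
    have 1: "signed_swap n x y k = k - (y - x)" using m by (auto simp: signed_swap_def)
    have 2: "2 * int n dvd k - (y - x) - x \<or> 2 * int n dvd k - (y - x) - (1 - y)"
      using m(1) by (auto simp: algebra_simps)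
    show ?thesis unfolding 1 using 2 by (auto simp: signed_swap_def)
  next
    case z
    then show ?thesis by (auto simp: signed_swap_def)
  qed
qed

lemma signed_affine_signed_swap:
  assumes "\<not> 2 * int n dvd y - x"
  shows "signed_affine n (signed_swap n x y)"
  unfolding signed_affine_def
proof (intro conjI allI)
  show "bij (signed_swap n x y)"
    using signed_swap_involution[OF assms] by (intro o_bij[of "signed_swap n x y"]) auto
  fix k
  have "2 * int n dvd k + 2 * int n - a \<longleftrightarrow> 2 * int n dvd k - a" for a
    using dvd_add_triv_right_iff[of "2 * int n" "k - a"] by (simp add: algebra_simps)
  then show "signed_swap n x y (k + 2 * int n) = signed_swap n x y k + 2 * int n"
    by (auto simp: signed_swap_def)
  have f: "2 * int n dvd 1 - k - a \<longleftrightarrow> 2 * int n dvd k - (1 - a)" for a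
    using dvd_minus_iff[of "2 * int n" "1 - k - a"] by (simp add: algebra_simps)
  have g: "2 * int n dvd 1 - k - (1 - a) \<longleftrightarrow> 2 * int n dvd k - a" for a
    using f[of "1 - a"] by simp
  show "signed_swap n x y (1 - k) = 1 - signed_swap n x y k"
    unfolding signed_swap_def f g using signed_swap_exclusive[OF assms, of k] by auto
qed

section \<open>The generators of type B\<close>

lemma small_not_dvd:
  fixes z M :: int
  assumes "0 < \<bar>z\<bar>" "\<bar>z\<bar> < M"
  shows "\<not> M dvd z"
  using assms dvd_imp_le_int[of z M] by auto

lemma simple_refl_zero: "simple_refl (2 * n) 0 = signed_swap n 0 1"
  by (rule ext) (auto simp: simple_refl_alt signed_swap_def)

text \<open>
The classes \<open>i, i + 1\<close> and \<open>-i, 1 - i\<close> are pairwise disjoint modulo \<open>2n\<close>, because \<open>2i\<close> is not divisible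
by \<open>2n\<close> and \<open>2i - 1\<close>, \<open>2i + 1\<close> are odd. So the two simple reflections act independently.
\<close>

lemma simple_refl_pair:
  assumes "1 \<le> i" "i < n"
  shows "word_prod (simple_refl (2 * n)) [i, 2 * n - i] = signed_swap n (int i) (int i + 1)"
proof
  fix k
  let ?M = "2 * int n"
  let ?i = "int i"
  have e: "int (2 * n - i) = ?M - ?i" using assms by (simp add: of_nat_diff)
  have c: "?M dvd k - (?M - ?i) \<longleftrightarrow> ?M dvd k + ?i"
      "?M dvd k - 1 - (?M - ?i) \<longleftrightarrow> ?M dvd k - 1 + ?i" for k
    using dvd_add_triv_right_iff[of ?M "k - (?M - ?i)"] dvd_add_triv_right_iff[of ?M "k - 1 - (?M - ?i)"]
    by (simp_all add: algebra_simps)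
  have n2: "\<not> ?M dvd 2 * ?i" using assms by (intro small_not_dvd) auto
  note odd = not_even_dvd_odd[of n ?i]
  have cd: "\<not> ?M dvd k + 1 - ?i" "\<not> ?M dvd k - ?i" "\<not> ?M dvd k - 1 - ?i" "\<not> ?M dvd k - 1 + ?i" if "?M dvd k + ?i"
    using that n2 odd not_even_dvd_odd[of n 0] dvd_diff[of ?M "k + ?i" "k + 1 - ?i"]
      dvd_diff[of ?M "k + ?i" "k - ?i"] dvd_diff[of ?M "k + ?i" "k - 1 - ?i"]
      dvd_diff[of ?M "k + ?i" "k - 1 + ?i"] by (auto simp: algebra_simps)
  have dd: "\<not> ?M dvd k - 1 - ?i" "\<not> ?M dvd k - 2 - ?i" "\<not> ?M dvd k - ?i" if "?M dvd k - 1 + ?i"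
    using that n2 odd dvd_diff[of ?M "k - 1 + ?i" "k - 1 - ?i"]
      dvd_diff[of ?M "k - 1 + ?i" "k - 2 - ?i"] dvd_diff[of ?M "k - 1 + ?i" "k - ?i"]
    by (auto simp: algebra_simps)
  have s: "simple_refl (2 * n) (2 * n - i) k =
     (if ?M dvd k + ?i then k + 1 else if ?M dvd k - 1 + ?i then k - 1 else k)"
    unfolding simple_refl_alt e using c by simp
  show "word_prod (simple_refl (2 * n)) [i, 2 * n - i] k = signed_swap n ?i (?i + 1) k"
  proof -
    have "word_prod (simple_refl (2 * n)) [i, 2 * n - i] k =
        simple_refl (2 * n) i (simple_refl (2 * n) (2 * n - i) k)" by simp
    also have "\<dots> = signed_swap n ?i (?i + 1) k"
      unfolding s simple_refl_alt[of "2 * n" i] signed_swap_def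
      using cd dd by (auto simp: algebra_simps)
    finally show ?thesis .
  qed
qed

lemma simple_refl_middle: "simple_refl (2 * n) n = signed_swap n (int n) (int n + 1)"
proof
  fix k
  have "2 * int n dvd k + int n \<longleftrightarrow> 2 * int n dvd k - int n"
    "2 * int n dvd k - 1 + int n \<longleftrightarrow> 2 * int n dvd k - 1 - int n"
    using dvd_add_triv_right_iff[of "2 * int n" "k - int n"]
      dvd_add_triv_right_iff[of "2 * int n" "k - 1 - int n"] by (simp_all add: algebra_simps)
  then show "simple_refl (2 * n) n k = signed_swap n (int n) (int n + 1) k"
    by (auto simp: simple_refl_alt signed_swap_def algebra_simps)
qed

lemma simple_refl_B_pos:
  assumes "1 \<le> i" "i \<le> n"
  shows "simple_refl_B n i = signed_swap n (int i) (int i + 1)"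
proof (cases "i = n")
  case True
  then show ?thesis using assms simple_refl_middle[of n] by (simp add: simple_refl_B_def)
next
  case False
  then have "i < n" using assms by simp
  then have "simple_refl_B n i = word_prod (simple_refl (2 * n)) [i, 2 * n - i]"
    using assms by (simp add: simple_refl_B_def)
  then show ?thesis using simple_refl_pair[OF assms(1) \<open>i < n\<close>] by simp
qed

lemma signed_affine_simple_refl_zero:
  assumes "1 \<le> n"
  shows "signed_affine n (simple_refl (2 * n) 0)"
  unfolding simple_refl_zero using assms by (intro signed_affine_signed_swap small_not_dvd) auto

lemma simple_refl_zero_involution:
  assumes "1 \<le> n"
  shows "simple_refl (2 * n) 0 \<circ> simple_refl (2 * n) 0 = id"
proof -
  have "\<not> 2 * int n dvd 1 - 0" using assms by (intro small_not_dvd) auto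
  from signed_swap_involution[OF this] show ?thesis by (auto simp: simple_refl_zero)
qed

lemma simple_refl_zero_values:
  assumes "2 \<le> n"
  shows "simple_refl (2 * n) 0 0 = 1" "simple_refl (2 * n) 0 1 = 0"
    "2 \<le> k \<Longrightarrow> k < 2 * int n \<Longrightarrow> simple_refl (2 * n) 0 k = k"
  using assms small_not_dvd[of 1 "2 * int n"] small_not_dvd[of k "2 * int n"] small_not_dvd[of "k - 1" "2 * int n"]
  by (auto simp: simple_refl_alt)

text \<open>
The generator with index 0 is the conjugate by \<open>s\<^sub>0\<close> of the generator with index 1, and \<open>s\<^sub>0\<close> maps
the pair \<open>(1, 2)\<close> to \<open>(0, 2)\<close>.
\<close>

lemma simple_refl_B_zero:
  assumes "n \<ge> 2"
  shows "simple_refl_B n 0 = signed_swap n 0 2"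
proof -
  let ?s = "simple_refl (2 * n) 0"
  have "simple_refl_B n 0 = ?s \<circ> word_prod (simple_refl (2 * n)) [1, 2 * n - 1] \<circ> ?s"
    by (simp add: simple_refl_B_def comp_assoc)
  also have "word_prod (simple_refl (2 * n)) [1, 2 * n - 1] = signed_swap n 1 2"
    using simple_refl_pair[of 1 n] assms by simp
  also have "?s \<circ> signed_swap n 1 2 = signed_swap n (?s 1) (?s 2) \<circ> ?s"
    using assms by (intro signed_swap_conjugate signed_affine_simple_refl_zero) simp
  also have "\<dots> \<circ> ?s = signed_swap n (?s 1) (?s 2) \<circ> (?s \<circ> ?s)" by (rule comp_assoc)
  also have "\<dots> = signed_swap n 0 2"
    using simple_refl_zero_involution[of n] simple_refl_zero_values(2)[of n] simple_refl_zero_values(3)[of n 2] assms by simp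
  finally show ?thesis .
qed

definition generator_root :: "nat \<Rightarrow> int \<times> int" where
  "generator_root i = (if i = 0 then (0, 2) else (int i, int i + 1))"

lemma simple_refl_B_eq:
  assumes "n \<ge> 2" "i \<le> n"
  shows "simple_refl_B n i = signed_swap n (fst (generator_root i)) (snd (generator_root i))"
  using simple_refl_B_zero[OF assms(1)] simple_refl_B_pos[of i n] assms by (auto simp: generator_root_def)

lemma simple_refl_B_signed_affine:
  assumes "n \<ge> 2" "i \<le> n"
  shows "signed_affine n (simple_refl_B n i)" "simple_refl_B n i \<circ> simple_refl_B n i = id"
proof -
  have "\<not> 2 * int n dvd snd (generator_root i) - fst (generator_root i)"
    using assms by (intro small_not_dvd) (auto simp: generator_root_def)
  from signed_affine_signed_swap[OF this] signed_swap_involution[OF this]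
  show "signed_affine n (simple_refl_B n i)" "simple_refl_B n i \<circ> simple_refl_B n i = id"
    using simple_refl_B_eq[OF assms] by auto
qed

lemma signed_affine_word:
  assumes "n \<ge> 2" "set is \<subseteq> {0..n}"
  shows "signed_affine n (word_prod (simple_refl_B n) is)"
  using assms(2) by (induction "is") (auto intro: signed_affine_comp simple_refl_B_signed_affine[OF assms(1)])

lemma word_prod_B_as_A:
  assumes "n \<ge> 2" "set is \<subseteq> {0..n}"
  shows "\<exists>js. set js \<subseteq> {..<2 * n} \<and> word_prod (simple_refl_B n) is = word_prod (simple_refl (2 * n)) js"
  using assms(2)
proof (induction "is")
  case Nil
  then show ?case by (intro exI[of _ "[]"]) auto
next
  case (Cons i "is")
  then obtain js where js: "set js \<subseteq> {..<2 * n}"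
    "word_prod (simple_refl_B n) is = word_prod (simple_refl (2 * n)) js" by auto
  define xs where "xs = (if i = 0 then [0, 1, 2 * n - 1, 0] else if i < n then [i, 2 * n - i] else [n])"
  have "simple_refl_B n i = word_prod (simple_refl (2 * n)) xs" "set xs \<subseteq> {..<2 * n}"
    using assms(1) Cons.prems by (auto simp: simple_refl_B_def xs_def)
  then show ?case using js by (intro exI[of _ "xs @ js"]) (auto simp: word_prod_append)
qed

lemma affine_sym_simps: "\<one>\<^bsub>affine_sym N\<^esub> = id" "v \<otimes>\<^bsub>affine_sym N\<^esub> w = v \<circ> w"
  by (simp_all add: affine_sym_def)

text \<open>
The generators are involutions, so inverses contribute no further words.
\<close>

lemma generate_eq_words:
  assumes "n \<ge> 2" "J \<subseteq> {0..n}"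
  shows "generate (affine_sym (2 * n)) (simple_refl_B n ` J) =
    {word_prod (simple_refl_B n) is | is. set is \<subseteq> J}" (is "?L = ?R")
proof
  show "?L \<subseteq> ?R"
  proof
    fix w assume "w \<in> ?L"
    then show "w \<in> ?R"
    proof (induction rule: generate.induct)
      case one
      show ?case by (rule CollectI, rule exI[of _ "[]"]) (simp add: affine_sym_simps)
    next
      case (incl h)
      then obtain i where "i \<in> J" "h = simple_refl_B n i" by auto
      then show ?case by (intro CollectI exI[of _ "[i]"]) simp
    next
      case (inv h)
      then obtain i where i: "i \<in> J" "h = simple_refl_B n i" by auto
      have h: "h \<circ> h = id" "h \<in> carrier (affine_sym (2 * n))"
        using simple_refl_B_signed_affine[OF assms(1), of i] signed_affine_in_carrier i assms(2) by auto
      have "m_inv (affine_sym (2 * n)) h = h"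
        unfolding m_inv_def
      proof (rule the_equality)
        show "h \<in> carrier (affine_sym (2 * n)) \<and> h \<otimes>\<^bsub>affine_sym (2 * n)\<^esub> h = \<one>\<^bsub>affine_sym (2 * n)\<^esub> \<and>
            h \<otimes>\<^bsub>affine_sym (2 * n)\<^esub> h = \<one>\<^bsub>affine_sym (2 * n)\<^esub>"
          using h by (simp add: affine_sym_simps)
        fix y assume "y \<in> carrier (affine_sym (2 * n)) \<and> h \<otimes>\<^bsub>affine_sym (2 * n)\<^esub> y = \<one>\<^bsub>affine_sym (2 * n)\<^esub> \<and>
            y \<otimes>\<^bsub>affine_sym (2 * n)\<^esub> h = \<one>\<^bsub>affine_sym (2 * n)\<^esub>"
        then have "h \<circ> y = id" by (simp add: affine_sym_simps)
        then have "h \<circ> h \<circ> y = h" by (simp add: comp_assoc)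
        then show "y = h" by (simp add: h)
      qed
      then show ?case using i by (intro CollectI exI[of _ "[i]"]) simp
    next
      case (eng h1 h2)
      then obtain "is" js where "set is \<subseteq> J" "set js \<subseteq> J"
        "h1 = word_prod (simple_refl_B n) is" "h2 = word_prod (simple_refl_B n) js" by auto
      then show ?case
        by (intro CollectI exI[of _ "is @ js"]) (auto simp: affine_sym_def word_prod_append)
    qed
  qed
next
  show "?R \<subseteq> ?L"
  proof
    fix w assume "w \<in> ?R"
    then obtain "is" where "set is \<subseteq> J" "w = word_prod (simple_refl_B n) is" by auto
    moreover have "set is \<subseteq> J \<Longrightarrow> word_prod (simple_refl_B n) is \<in> ?L"
    proof (induction "is")
      case Nil
      then show ?case using generate.one[of "affine_sym (2 * n)" "simple_refl_B n ` J"]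
        by (simp only: affine_sym_simps word_prod_Nil)
    next
      case (Cons i "is")
      have e: "word_prod (simple_refl_B n) (i # is) =
          simple_refl_B n i \<otimes>\<^bsub>affine_sym (2 * n)\<^esub> word_prod (simple_refl_B n) is"
        by (simp only: affine_sym_simps word_prod_Cons)
      show ?case unfolding e using Cons by (intro generate.eng[OF generate.incl]) simp_all
    qed
    ultimately show "w \<in> ?L" by simp
  qed
qed

section \<open>Inversions and the exchange condition\<close>

lemma signed_swap_shift:
  "signed_swap n (x + 2 * int n * q) (y + 2 * int n * q) = signed_swap n x y"
proof
  fix k
  have d: "2 * int n dvd k - (a + 2 * int n * q) \<longleftrightarrow> 2 * int n dvd k - a"
    "2 * int n dvd k - (1 - (a + 2 * int n * q)) \<longleftrightarrow> 2 * int n dvd k - (1 - a)" for a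
  proof -
    have e: "k - (a + 2 * int n * q) = (k - a) + 2 * int n * (- q)"
      "k - (1 - (a + 2 * int n * q)) = (k - (1 - a)) + 2 * int n * q" by simp_all
    show "2 * int n dvd k - (a + 2 * int n * q) \<longleftrightarrow> 2 * int n dvd k - a"
      unfolding e(1) by (rule dvd_add_times_triv_right_iff[of "2 * int n" _ "- q", simplified mult.commute[of "- q"]])
    show "2 * int n dvd k - (1 - (a + 2 * int n * q)) \<longleftrightarrow> 2 * int n dvd k - (1 - a)"
      unfolding e(2) by (rule dvd_add_times_triv_right_iff[of "2 * int n" _ q, simplified mult.commute[of q]])
  qed
  show "signed_swap n (x + 2 * int n * q) (y + 2 * int n * q) k = signed_swap n x y k"
    unfolding signed_swap_def d by simp
qed

lemma signed_swap_reflect: "signed_swap n (1 - y) (1 - x) = signed_swap n x y"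
  by (rule ext) (auto simp: signed_swap_def)

lemma dvd_window:
  fixes z M :: int
  assumes "\<bar>z\<bar> < 2 * M"
  shows "M dvd z \<longleftrightarrow> z = 0 \<or> z = M \<or> z = - M"
proof
  assume "M dvd z"
  then obtain q where q: "z = M * q" by (rule dvdE)
  have "M > 0" using assms by linarith
  then have "\<bar>q\<bar> < 2" using assms unfolding q abs_mult by (simp add: mult.commute)
  then have "q = 0 \<or> q = 1 \<or> q = -1" by linarith
  then show "z = 0 \<or> z = M \<or> z = - M" using q by auto
qed auto

text \<open>
On one period, extended by three positions to leave room for the longest inversion.
\<close>

lemma simple_refl_B_zero_window:
  assumes "n \<ge> 3" "- 1 \<le> k" "k \<le> 2 * int n + 1"
  shows "simple_refl_B n 0 k =
    (if k = -1 \<or> k = 0 \<or> k = 2 * int n - 1 \<or> k = 2 * int n then k + 2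
     else if k = 1 \<or> k = 2 \<or> k = 2 * int n + 1 then k - 2 else k)"
proof -
  have "2 * int n dvd k - 0 \<longleftrightarrow> k = 0 \<or> k = 2 * int n"
    "2 * int n dvd k - (1 - 2) \<longleftrightarrow> k = - 1 \<or> k = 2 * int n - 1"
    "2 * int n dvd k - 2 \<longleftrightarrow> k = 2"
    "2 * int n dvd k - (1 - 0) \<longleftrightarrow> k = 1 \<or> k = 2 * int n + 1"
    by (subst dvd_window; use assms in linarith)+
  then show ?thesis
    unfolding simple_refl_B_zero[OF order_trans[OF _ assms(1), of 2, simplified]] signed_swap_def
    using assms by presburger
qed

text \<open>
A generator inverts only its own root. The generator with index 0 also inverts the pairs
\<open>(0, 1)\<close> and \<open>(-1, 2)\<close> up to translation; for these \<open>x + y \<equiv> 1\<close> modulo \<open>4n\<close>. They are roots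
of type C but not of type B, and the last assumption excludes them.
\<close>

lemma inversion_is_root:
  assumes n: "n \<ge> 3" and a: "a \<le> n" and xy: "x < y"
    and inv: "simple_refl_B n a y < simple_refl_B n a x"
    and odd: "\<not> 4 * int n dvd x + y - 1"
  shows "signed_swap n x y = simple_refl_B n a"
proof (cases "a = 0")
  case False
  let ?M = "2 * int n"
  have e: "simple_refl_B n a = signed_swap n (int a) (int a + 1)"
    using simple_refl_B_pos[of a n] a False by simp
  have up: "signed_swap n (int a) (int a + 1) k \<le> k + 1" "k - 1 \<le> signed_swap n (int a) (int a + 1) k" for k
    by (auto simp: signed_swap_def)
  have y: "y = x + 1" using inv up(1)[of x] up(2)[of y] xy unfolding e by linarith
  have "?M dvd x - int a \<or> ?M dvd x - (- int a)"
  proof (rule ccontr)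
    assume "\<not> ?thesis"
    then have "signed_swap n (int a) (int a + 1) x \<le> x" "y \<le> signed_swap n (int a) (int a + 1) y"
      unfolding y by (auto simp: signed_swap_def)
    then show False using inv xy unfolding e by linarith
  qed
  then show ?thesis
  proof
    assume "?M dvd x - int a"
    then obtain q where "x - int a = ?M * q" by (rule dvdE)
    then have "x = int a + ?M * q" "y = int a + 1 + ?M * q" using y by linarith+
    then show ?thesis unfolding e by (simp only: signed_swap_shift)
  next
    assume "?M dvd x - (- int a)"
    then obtain q where "x - (- int a) = ?M * q" by (rule dvdE)
    then have "x = (1 - (int a + 1)) + ?M * q" "y = (1 - int a) + ?M * q" using y by linarith+
    then show ?thesis unfolding e by (simp only: signed_swap_shift signed_swap_reflect)
  qed
next
  case True
  let ?M = "2 * int n" and ?t = "simple_refl_B n 0"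
  define q r where "q = (x + 1) div ?M" and "r = (x + 1) mod ?M - 1"
  have x: "x = r + ?M * q"
    unfolding q_def r_def using mult_div_mod_eq[of ?M "x + 1"] by linarith
  have r: "- 1 \<le> r" "r < ?M - 1"
    unfolding r_def using n pos_mod_sign[of ?M "x + 1"] pos_mod_bound[of ?M "x + 1"] by linarith+
  define d where "d = y - x"
  have y: "y = (r + d) + ?M * q" and d: "0 < d" using x xy by (simp_all add: d_def)
  have sa: "signed_affine n ?t" using simple_refl_B_signed_affine(1)[of n 0] n by simp
  have less: "?t (r + d) < ?t r"
    using inv unfolding True x y signed_affine_shift[OF sa] by simp
  have "\<bar>?t k - k\<bar> \<le> 2" for k
    using simple_refl_B_zero[of n] n by (simp add: signed_swap_def)
  from this[of r] this[of "r + d"] less have d4: "d < 4" by linarith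
  \<comment> \<open>Every move has length at most 2, so an inverted pair straddles the block
    \<open>-1, 0, 1, 2\<close>, whose lower half moves up and whose upper half moves down.\<close>
  have cases: "r = -1 \<and> d = 2 \<or> r = 0 \<and> d = 2 \<or> r = 0 \<and> d = 1 \<or> r = -1 \<and> d = 3"
  proof -
    have "r + d \<le> ?M + 1" using r d4 by linarith
    then have "?t (r + d) =
      (if r + d = -1 \<or> r + d = 0 \<or> r + d = ?M - 1 \<or> r + d = ?M then r + d + 2
       else if r + d = 1 \<or> r + d = 2 \<or> r + d = ?M + 1 then r + d - 2 else r + d)"
      using simple_refl_B_zero_window[OF n, of "r + d"] r d by simp
    moreover have "?t r = (if r = -1 \<or> r = 0 then r + 2 else if r = 1 \<or> r = 2 then r - 2 else r)"
      using simple_refl_B_zero_window[OF n, of r] r by simp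
    moreover have "6 \<le> ?M" using n by simp
    ultimately show ?thesis using less r d d4 by (smt (verit))
  qed
  \<comment> \<open>The last two alternatives are the pairs with \<open>x + y \<equiv> 1\<close> modulo \<open>4n\<close>.\<close>
  have "\<not> (2 * r + d = 1)"
  proof
    assume "2 * r + d = 1"
    then have "x + y - 1 = 4 * int n * q" unfolding x y by (simp add: algebra_simps)
    then show False using odd by simp
  qed
  then have "r = -1 \<and> d = 2 \<or> r = 0 \<and> d = 2" using cases by linarith
  then show ?thesis
  proof
    assume h: "r = -1 \<and> d = 2"
    have "signed_swap n x y = signed_swap n (1 - 2) (1 - 0)"
      unfolding x y signed_swap_shift using h by simp
    then show ?thesis unfolding True simple_refl_B_zero[OF order_trans[OF _ n], simplified] signed_swap_reflect .
  next
    assume h: "r = 0 \<and> d = 2"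
    then show ?thesis using simple_refl_B_zero[of n] n unfolding True x y signed_swap_shift by simp
  qed
qed

text \<open>
Images of the finite simple roots are roots of type B. For \<open>i = n\<close> the sum is always \<open>2n + 1\<close>;
for \<open>i < n\<close>, already a congruence modulo \<open>2n\<close> would give \<open>i + 1 \<equiv> 1 - i\<close>.
\<close>

lemma root_image_not_special:
  assumes w: "signed_affine n w" and i: "1 \<le> i" "i \<le> n"
  shows "\<not> 4 * int n dvd w (int i) + w (int i + 1) - 1"
proof (cases "i = n")
  case True
  have "int n + 1 = (1 - int n) + 2 * int n * 1" by simp
  then have "w (int n + 1) = 1 - w (int n) + 2 * int n"
    using signed_affine_shift[OF w, of "1 - int n" 1] signed_affine_reflect[OF w, of "int n"] by simp
  then have "w (int i) + w (int i + 1) - 1 = 2 * int n" using True by simp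
  then show ?thesis using small_not_dvd[of "2 * int n" "4 * int n"] i by simp
next
  case False
  show ?thesis
  proof
    assume "4 * int n dvd w (int i) + w (int i + 1) - 1"
    moreover have "2 * int n dvd 4 * int n" by (rule dvdI[of _ _ 2]) simp
    ultimately have "2 * int n dvd w (int i) + w (int i + 1) - 1" by (rule dvd_trans[rotated])
    then have "2 * int n dvd w (int i + 1) - w (1 - int i)"
      unfolding signed_affine_reflect[OF w] by (simp add: algebra_simps)
    then have "2 * int n dvd (int i + 1) - (1 - int i)" unfolding signed_affine_dvd_iff[OF w] .
    then have "2 * int n dvd 2 * int i" by simp
    then show False using small_not_dvd[of "2 * int i" "2 * int n"] i False by simp
  qed
qed

text \<open>
The suffixes of the word send the pair \<open>(i, i + 1)\<close> first to an increasing and finally to a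
decreasing pair. The letter \<open>a\<close> at which the order changes inverts the current pair
\<open>(v i, v (i + 1))\<close>, so it is the reflection in that pair. By conjugation \<open>v \<circ> t\<^sub>i = t\<^sub>a \<circ> v\<close> for the generators \<open>t\<close> of type B, and the
letter cancels.
\<close>

lemma exchange:
  assumes n: "n \<ge> 3" and i: "1 \<le> i" "i \<le> n" and "set is \<subseteq> {0..n}"
    and "word_prod (simple_refl_B n) is (int i + 1) < word_prod (simple_refl_B n) is (int i)"
  shows "\<exists>js. set js \<subseteq> {0..n} \<and> length js < length is \<and>
    word_prod (simple_refl_B n) js = word_prod (simple_refl_B n) is \<circ> simple_refl_B n i"
  using assms(4,5)
proof (induction "is")
  case Nil
  then show ?case by simp
next
  case (Cons a "is")
  define v where "v = word_prod (simple_refl_B n) is"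
  have sv: "signed_affine n v"
    unfolding v_def using signed_affine_word[of n "is"] Cons.prems n by simp
  have neq: "v (int i) \<noteq> v (int i + 1)" by (simp add: signed_affine_inj[OF sv])
  show ?case
  proof (cases "v (int i + 1) < v (int i)")
    case True
    have "set is \<subseteq> {0..n}" using Cons.prems by simp
    from Cons.IH[OF this True[unfolded v_def], folded v_def]
    obtain js where js: "set js \<subseteq> {0..n}" "length js < length is"
      "word_prod (simple_refl_B n) js = v \<circ> simple_refl_B n i" by blast
    have "word_prod (simple_refl_B n) (a # js) = word_prod (simple_refl_B n) (a # is) \<circ> simple_refl_B n i"
      by (simp only: word_prod_Cons js(3) v_def comp_assoc)
    moreover have "set (a # js) \<subseteq> {0..n}" "length (a # js) < length (a # is)"
      using js(1,2) Cons.prems(1) by auto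
    ultimately show ?thesis by blast
  next
    case False
    then have less: "v (int i) < v (int i + 1)" using neq by simp
    have a: "a \<le> n" using Cons.prems by simp
    have inv: "simple_refl_B n a (v (int i + 1)) < simple_refl_B n a (v (int i))"
      using Cons.prems(2) by (simp add: v_def)
    have "v \<circ> simple_refl_B n i = signed_swap n (v (int i)) (v (int i + 1)) \<circ> v"
      unfolding simple_refl_B_pos[OF i] by (rule signed_swap_conjugate[OF sv])
    also have "signed_swap n (v (int i)) (v (int i + 1)) = simple_refl_B n a"
      by (rule inversion_is_root[OF n a less inv root_image_not_special[OF sv i]])
    finally have "simple_refl_B n a \<circ> v \<circ> simple_refl_B n i = (simple_refl_B n a \<circ> simple_refl_B n a) \<circ> v"
      by (simp only: comp_assoc)
    also have "\<dots> = v"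
      unfolding simple_refl_B_signed_affine(2)[OF order_trans[OF _ n, of 2, simplified] a] by (rule id_comp)
    finally have "word_prod (simple_refl_B n) is = word_prod (simple_refl_B n) (a # is) \<circ> simple_refl_B n i"
      by (simp only: word_prod_Cons v_def)
    moreover have "set is \<subseteq> {0..n}" "length is < length (a # is)" using Cons.prems(1) by auto
    ultimately show ?thesis by blast
  qed
qed

lemma length_B_le:
  assumes "set is \<subseteq> {0..n}"
  shows "length_B n (word_prod (simple_refl_B n) is) \<le> length is"
  unfolding length_B_def using assms by (intro Least_le) blast

lemma length_B_witness:
  assumes "set is \<subseteq> {0..n}"
  shows "\<exists>js. length js = length_B n (word_prod (simple_refl_B n) is) \<and> set js \<subseteq> {0..n} \<and>
    word_prod (simple_refl_B n) is = word_prod (simple_refl_B n) js"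
  unfolding length_B_def by (rule LeastI) (use assms in blast)

lemma descent_shortens:
  assumes n: "n \<ge> 3" and i: "1 \<le> i" "i \<le> n" and "is": "set is \<subseteq> {0..n}"
    and w: "w = word_prod (simple_refl_B n) is" and desc: "w (int i + 1) < w (int i)"
  shows "length_B n (w \<circ> simple_refl_B n i) < length_B n w"
proof -
  obtain js where js: "length js = length_B n w" "set js \<subseteq> {0..n}" "w = word_prod (simple_refl_B n) js"
    using length_B_witness[OF "is"] w by blast
  obtain ks where ks: "set ks \<subseteq> {0..n}" "length ks < length js"
    "word_prod (simple_refl_B n) ks = w \<circ> simple_refl_B n i"
    using exchange[OF n i js(2)] desc js(3) by blast
  then show ?thesis using length_B_le[OF ks(1)] js(1) by simp
qed

section \<open>The parity of the diagonal\<close>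

lemma symmetric_set_image:
  assumes "signed_affine n w" "symmetric_set B"
  shows "symmetric_set (w ` B)"
  unfolding symmetric_set_def
proof
  fix k
  have "surj w" using assms(1) by (simp add: signed_affine_def bij_def)
  then obtain c where c: "k = w c" by (rule surjE)
  have m: "w x \<in> w ` B \<longleftrightarrow> x \<in> B" for x
    using assms(1) by (intro inj_image_mem_iff) (simp add: signed_affine_def bij_is_inj)
  have "1 - k \<in> w ` B \<longleftrightarrow> 1 - c \<in> B"
    unfolding c signed_affine_reflect[OF assms(1), symmetric] by (rule m)
  then show "k \<in> w ` B \<longleftrightarrow> 1 - k \<notin> w ` B"
    using m[of c] assms(2) unfolding c symmetric_set_def by blast
qed

lemma simple_refl_B_image:
  assumes "n \<ge> 2" "a \<le> n"
  shows "k \<in> simple_refl_B n a ` B \<longleftrightarrow> simple_refl_B n a k \<in> B"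
proof -
  have "simple_refl_B n a (simple_refl_B n a k) = k" for k
    using simple_refl_B_signed_affine(2)[OF assms] by (simp add: fun_eq_iff)
  then show ?thesis by (metis imageE imageI)
qed

lemma simple_refl_B_pos_threshold:
  assumes "n \<ge> 2" "1 \<le> a" "a \<le> n"
  shows "1 \<le> simple_refl_B n a k \<longleftrightarrow> 1 \<le> k"
proof -
  have nd: "\<not> 2 * int n dvd int a" "\<not> 2 * int n dvd - int a"
    using assms by (intro small_not_dvd; simp)+
  have e: "simple_refl_B n a = signed_swap n (int a) (int a + 1)"
    by (rule simple_refl_B_pos[OF assms(2,3)])
  have b: "\<bar>signed_swap n (int a) (int a + 1) k - k\<bar> \<le> 1" by (simp add: signed_swap_def)
  have 0: "signed_swap n (int a) (int a + 1) 0 \<le> 0" using nd by (auto simp: signed_swap_def)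
  have 1: "1 \<le> signed_swap n (int a) (int a + 1) 1" using nd by (auto simp: signed_swap_def)
  consider "k \<ge> 2" | "k \<le> - 1" | "k = 0" | "k = 1" by linarith
  then show ?thesis unfolding e using b 0 1 by cases auto
qed

lemma simple_refl_B_zero_threshold:
  assumes "n \<ge> 3"
  shows "3 \<le> simple_refl_B n 0 k \<longleftrightarrow> 3 \<le> k"
proof -
  have b: "\<bar>simple_refl_B n 0 k - k\<bar> \<le> 2"
    using simple_refl_B_zero[of n] assms by (simp add: signed_swap_def)
  consider "k \<ge> 5" | "k \<le> 0" | "k = 1" | "k = 2" | "k = 3" | "k = 4" by linarith
  then show ?thesis
    using b simple_refl_B_zero_window[OF assms, of k] assms by cases auto
qed

lemma image_above_threshold:
  fixes f :: "int \<Rightarrow> int"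
  assumes "\<And>k. c \<le> f k \<longleftrightarrow> c \<le> k"
  shows "f ` B \<inter> {c..} = f ` (B \<inter> {c..})"
  using assms by auto

text \<open>
The generators with index at least 1 preserve the positive integers. The one with index 0 preserves
\<open>{3..}\<close> and exchanges \<open>{1, 2}\<close> with \<open>{-1, 0}\<close>; by symmetry the latter carries two minus as
many beads as the former.
\<close>

lemma parity_step:
  assumes n: "n \<ge> 3" and a: "a \<le> n" and B: "symmetric_set B" "finite (B \<inter> {1..})"
  shows "finite (simple_refl_B n a ` B \<inter> {1..}) \<and>
    even (card (simple_refl_B n a ` B \<inter> {1..})) = even (card (B \<inter> {1..}))"
proof -
  have n2: "n \<ge> 2" using n by simp
  have inj: "inj_on (simple_refl_B n a) Z" for Z
    using signed_affine_inj[OF simple_refl_B_signed_affine(1)[OF n2 a]] by (simp add: inj_on_def)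
  show ?thesis
  proof (cases "a = 0")
    case False
    then have "simple_refl_B n a ` B \<inter> {1..} = simple_refl_B n a ` (B \<inter> {1..})"
      using a n2 by (intro image_above_threshold simple_refl_B_pos_threshold) auto
    then show ?thesis using B(2) by (simp add: card_image[OF inj])
  next
    case True
    define C where "C = simple_refl_B n 0 ` B"
    have parts: "Z \<inter> {1..} = (Z \<inter> {1, 2}) \<union> (Z \<inter> {3..})" for Z :: "int set" by auto
    have cnt: "card (Z \<inter> {1..}) = of_bool (1 \<in> Z) + of_bool (2 \<in> Z) + card (Z \<inter> {3..})"
      if "finite (Z \<inter> {3..})" for Z :: "int set"
    proof -
      have "card (Z \<inter> {1..}) = card (Z \<inter> {1, 2}) + card (Z \<inter> {3..})"
        by (subst parts, rule card_Un_disjoint[OF _ that]) auto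
      moreover have "card (Z \<inter> {1, 2}) = of_bool (1 \<in> Z) + of_bool (2 \<in> Z)"
        by (cases "1 \<in> Z"; cases "2 \<in> Z"; simp)
      ultimately show ?thesis by simp
    qed
    have above: "C \<inter> {3..} = simple_refl_B n 0 ` (B \<inter> {3..})"
      unfolding C_def by (intro image_above_threshold simple_refl_B_zero_threshold[OF n])
    have finB: "finite (B \<inter> {3..})" using B(2) by (rule rev_finite_subset) auto
    have finC: "finite (C \<inter> {3..})" unfolding above using finB by simp
    have card3: "card (C \<inter> {3..}) = card (B \<inter> {3..})"
      unfolding above using inj True by (simp add: card_image)
    have "simple_refl_B n 0 1 = -1" "simple_refl_B n 0 2 = 0"
      using simple_refl_B_zero_window[OF n] n by simp_all
    then have "1 \<in> C \<longleftrightarrow> - 1 \<in> B" "2 \<in> C \<longleftrightarrow> 0 \<in> B"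
      unfolding C_def using simple_refl_B_image[OF n2, of 0] by simp_all
    \<comment> \<open>The symmetry of \<open>B\<close> trades the beads at \<open>-1\<close> and \<open>0\<close> for gaps at \<open>2\<close> and \<open>1\<close>.\<close>
    then have flip: "1 \<in> C \<longleftrightarrow> 2 \<notin> B" "2 \<in> C \<longleftrightarrow> 1 \<notin> B"
      using B(1)[unfolded symmetric_set_def, rule_format, of "-1"]
        B(1)[unfolded symmetric_set_def, rule_format, of 0] by simp_all
    have "finite (C \<inter> {1..})" unfolding parts using finC by simp
    moreover have "even (card (C \<inter> {1..})) = even (card (B \<inter> {1..}))"
      unfolding cnt[OF finC] cnt[OF finB] flip card3 by auto
    ultimately show ?thesis unfolding True C_def by simp
  qed
qed

lemma parity_word:
  assumes n: "n \<ge> 3" and "set is \<subseteq> {0..n}" and B: "symmetric_set B" "finite (B \<inter> {1..})"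
  shows "symmetric_set (word_prod (simple_refl_B n) is ` B) \<and>
    finite (word_prod (simple_refl_B n) is ` B \<inter> {1..}) \<and>
    even (card (word_prod (simple_refl_B n) is ` B \<inter> {1..})) = even (card (B \<inter> {1..}))"
  using assms(2)
proof (induction "is")
  case Nil
  then show ?case using B by simp
next
  case (Cons a "is")
  have e: "word_prod (simple_refl_B n) (a # is) ` B = simple_refl_B n a ` (word_prod (simple_refl_B n) is ` B)"
    by (simp add: image_comp)
  have a: "a \<le> n" "2 \<le> n" "set is \<subseteq> {0..n}" using Cons.prems n by auto
  have sym: "symmetric_set (word_prod (simple_refl_B n) is ` B)"
    and fin: "finite (word_prod (simple_refl_B n) is ` B \<inter> {1..})"
    and par: "even (card (word_prod (simple_refl_B n) is ` B \<inter> {1..})) = even (card (B \<inter> {1..}))"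
    using Cons.IH[OF a(3)] by blast+
  show ?case
    unfolding e using symmetric_set_image[OF simple_refl_B_signed_affine(1)[OF a(2,1)] sym]
      parity_step[OF n a(1) sym fin] par by simp
qed

lemma symmetric_set_atMost: "symmetric_set {..0}"
  by (auto simp: symmetric_set_def)

section \<open>Every self-conjugate core is reached\<close>

text \<open>
A bead with a gap on its left gives a removable node, so here the reflection removes boxes.
\<close>

lemma removal_step:
  assumes D: "D \<in> cores N" and N: "2 \<le> N" and i: "i < N"
    and c: "int N dvd c - int i" "c + 1 \<in> beads D" "c \<notin> beads D"
  shows "core_reflection N i D \<in> cores N"
    "beads (core_reflection N i D) = simple_refl N i ` beads D"
    "card (core_reflection N i D) < card D"
proof -
  have Y: "young_diagram D" using D by (simp add: cores_def)
  obtain r where "1 \<le> r" "c + 1 = bead D r" using c(2) by (auto simp: beads_def)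
  then have "1 \<le> r \<and> int N dvd bead D r - 1 - int i \<and> bead D r - 1 \<notin> beads D"
    using c(1,3) by (metis add_diff_cancel_right')
  then have ne: "removable_nodes N i D \<noteq> {}" unfolding removable_nodes_eq[OF Y i] by blast
  then have "core_reflection N i D \<subset> D"
    by (auto simp: core_reflection_def removable_nodes_def)
  moreover have "finite D" using Y by (simp add: young_diagram_def)
  ultimately show "card (core_reflection N i D) < card D" by (rule psubset_card_mono[rotated])
  show "core_reflection N i D \<in> cores N" "beads (core_reflection N i D) = simple_refl N i ` beads D"
    using core_reflection_beads[OF D N i] by blast+
qed

text \<open>
A box \<open>(r, j)\<close> with \<open>r + j\<close> maximal is a removable corner.
\<close>

lemma exists_corner:
  assumes Y: "young_diagram D" and ne: "D \<noteq> {}"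
  shows "\<exists>c. c + 1 \<in> beads D \<and> c \<notin> beads D"
proof -
  have fin: "finite D" using Y by (simp add: young_diagram_def)
  define m where "m = Max ((\<lambda>(r, j). r + j) ` D)"
  have "m \<in> (\<lambda>(r, j). r + j) ` D" unfolding m_def using fin ne by (intro Max_in) auto
  then obtain r j where rj: "(r, j) \<in> D" "m = r + j" by auto
  have le: "a + b \<le> r + j" if "(a, b) \<in> D" for a b
  proof -
    have "(\<lambda>(r, j). r + j) (a, b) \<le> m" unfolding m_def using fin that by (intro Max_ge) blast+
    then show ?thesis using rj(2) by simp
  qed
  have "young_diagram (D - {(r, j)})"
  proof (rule youngI)
    show "finite (D - {(r, j)})" using fin by simp
    show "1 \<le> a \<and> 1 \<le> b" if "(a, b) \<in> D - {(r, j)}" for a b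
      using that young_pos[OF Y] by auto
    show "(a', b') \<in> D - {(r, j)}"
      if "(a, b) \<in> D - {(r, j)}" "1 \<le> a'" "a' \<le> a" "1 \<le> b'" "b' \<le> b" for a b a' b'
      using that young_closed[OF Y, of a b a' b'] le[of a b] by auto
  qed
  then have "1 \<le> r" "bead D r - 1 \<notin> beads D"
    using rj(1) removable_corner_iff[OF Y] by blast+
  then show ?thesis using bead_in_beads[of r D] by (intro exI[of _ "bead D r - 1"]) simp
qed

text \<open>
\<open>s\<^sub>0\<close> induces the automorphism of the Dynkin diagram of type B that exchanges the two ends of its
fork.
\<close>

lemma simple_refl_zero_conjugates:
  assumes n: "n \<ge> 2" and a: "a \<le> n"
  defines "\<sigma> \<equiv> (\<lambda>a::nat. if a = 0 then 1 else if a = 1 then 0 else a)"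
  shows "simple_refl (2 * n) 0 \<circ> simple_refl_B n a = simple_refl_B n (\<sigma> a) \<circ> simple_refl (2 * n) 0"
proof -
  let ?s = "simple_refl (2 * n) 0"
  note v = simple_refl_zero_values[OF n]
  have c: "?s \<circ> signed_swap n x y = signed_swap n (?s x) (?s y) \<circ> ?s" for x y
    using n by (intro signed_swap_conjugate signed_affine_simple_refl_zero) simp
  consider "a = 0" | "a = 1" | "2 \<le> a" by linarith
  then show ?thesis
  proof cases
    case 1
    have "?s 2 = 2" using v(3)[of 2] n by simp
    then show ?thesis using 1 c[of 0 2] v(1) simple_refl_B_zero[OF n] simple_refl_B_pos[of 1 n] n
      by (simp add: \<sigma>_def)
  next
    case 2
    have "?s 2 = 2" using v(3)[of 2] n by simp
    then show ?thesis using 2 c[of 1 2] v(2) simple_refl_B_zero[OF n] simple_refl_B_pos[of 1 n] n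
      by (simp add: \<sigma>_def)
  next
    case 3
    have "?s (int a) = int a" "?s (int a + 1) = int a + 1"
      using v(3)[of "int a"] v(3)[of "int a + 1"] 3 a n by simp_all
    then show ?thesis using 3 c[of "int a" "int a + 1"] simple_refl_B_pos[of a n] a
      by (simp add: \<sigma>_def)
  qed
qed

lemma simple_refl_zero_past_word:
  assumes n: "n \<ge> 2" and "set is \<subseteq> {0..n}"
  shows "\<exists>js. set js \<subseteq> {0..n} \<and>
    simple_refl (2 * n) 0 \<circ> word_prod (simple_refl_B n) is = word_prod (simple_refl_B n) js \<circ> simple_refl (2 * n) 0"
  using assms(2)
proof (induction "is")
  case Nil
  then show ?case by (intro exI[of _ "[]"]) simp
next
  case (Cons a "is")
  then have "set is \<subseteq> {0..n}" by simp
  from Cons.IH[OF this] obtain js where js: "set js \<subseteq> {0..n}"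
    "simple_refl (2 * n) 0 \<circ> word_prod (simple_refl_B n) is = word_prod (simple_refl_B n) js \<circ> simple_refl (2 * n) 0"
    by blast
  define b :: nat where "b = (if a = 0 then 1 else if a = 1 then 0 else a)"
  have "simple_refl (2 * n) 0 \<circ> simple_refl_B n a = simple_refl_B n b \<circ> simple_refl (2 * n) 0"
    using simple_refl_zero_conjugates[OF n, of a] Cons.prems by (simp add: b_def)
  then have "simple_refl (2 * n) 0 \<circ> word_prod (simple_refl_B n) (a # is) =
      simple_refl_B n b \<circ> (simple_refl (2 * n) 0 \<circ> word_prod (simple_refl_B n) is)"
    by (simp only: word_prod_Cons comp_assoc[symmetric])
  also have "\<dots> = word_prod (simple_refl_B n) (b # js) \<circ> simple_refl (2 * n) 0"
    unfolding js(2) by (simp only: word_prod_Cons comp_assoc)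
  finally have "simple_refl (2 * n) 0 \<circ> word_prod (simple_refl_B n) (a # is) =
      word_prod (simple_refl_B n) (b # js) \<circ> simple_refl (2 * n) 0" .
  moreover have "set (b # js) \<subseteq> {0..n}" using js(1) Cons.prems n by (auto simp: b_def)
  ultimately show ?case by blast
qed

text \<open>
A corner of content \<open>c\<close> has a mirror image of content \<open>-c\<close>; one of the two has residue at most \<open>n\<close>.
\<close>

lemma corner_in_low_residue:
  assumes n: "n \<ge> 1" and B: "symmetric_set B" and c: "c + 1 \<in> B" "c \<notin> B"
  shows "\<exists>i\<le>n. \<exists>c. 2 * int n dvd c - int i \<and> c + 1 \<in> B \<and> c \<notin> B"
proof -
  let ?M = "2 * int n"
  have neg: "- c + 1 \<in> B" "- c \<notin> B"
    using B[unfolded symmetric_set_def, rule_format, of c] B[unfolded symmetric_set_def, rule_format, of "c + 1"] c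
    by (simp_all add: algebra_simps)
  define r where "r = c mod ?M"
  have r: "0 \<le> r" "r < ?M" using n by (simp_all add: r_def)
  have d: "?M dvd c - r" unfolding r_def by (simp add: minus_mod_eq_mult_div)
  show ?thesis
  proof (cases "r \<le> int n")
    case True
    then show ?thesis using r d c by (intro exI[of _ "nat r"] exI[of _ c] conjI) auto
  next
    case False
    have "?M dvd (- c - (?M - r))"
    proof -
      have "- c - (?M - r) = - (c - r) - ?M" by simp
      then show ?thesis using d by (metis dvd_diff dvd_minus_iff dvd_refl)
    qed
    then show ?thesis using r False neg
      by (intro exI[of _ "nat (?M - r)"] exI[of _ "- c"] conjI) auto
  qed
qed

lemma simple_refl_fixes:
  assumes "\<not> int N dvd k - int i" "\<not> int N dvd k - 1 - int i"
  shows "simple_refl N i k = k"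
  using assms by (simp add: simple_refl_alt)

text \<open>
For \<open>0 < i < n\<close> the generator is a product of two commuting reflections. The first removes the mirror
images of the corners of residue \<open>i\<close> and leaves the beads at \<open>c\<close> and \<open>c + 1\<close> alone, so that the
second one again removes boxes.
\<close>

lemma generator_removal:
  assumes n: "n \<ge> 2" and D: "D \<in> sc_cores (2 * n)" and ne: "D \<noteq> {}"
  shows "\<exists>E u. E \<in> sc_cores (2 * n) \<and> card E < card D \<and> beads D = u ` beads E \<and>
    (u = simple_refl (2 * n) 0 \<or> (\<exists>i\<in>{1..n}. u = simple_refl_B n i))"
proof -
  let ?N = "2 * n" and ?M = "2 * int n"
  have core: "D \<in> cores ?N" and conj: "conjugate D = D" using D by (auto simp: sc_cores_def)
  have Y: "young_diagram D" using core by (simp add: cores_def)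
  have N: "2 \<le> ?N" and n1: "1 \<le> n" using n by simp_all
  have sym: "symmetric_set (beads D)" using conj self_conjugate_iff[OF Y] by blast
  obtain i c where i: "i \<le> n" and c: "?M dvd c - int i" "c + 1 \<in> beads D" "c \<notin> beads D"
    using exists_corner[OF Y ne] corner_in_low_residue[OF n1 sym] by blast
  \<comment> \<open>The symmetry of the bead set, hence self-conjugacy, is inherited from \<open>u\<close> being signed.\<close>
  have finish: ?thesis
    if "E \<in> cores ?N" "card E < card D" "beads E = u ` beads D" "signed_affine n u" "u \<circ> u = id"
      "u = simple_refl (2 * n) 0 \<or> (\<exists>i\<in>{1..n}. u = simple_refl_B n i)" for E u
  proof (intro exI[of _ E] exI[of _ u] conjI)
    have "young_diagram E" using that(1) by (simp add: cores_def)
    moreover have "symmetric_set (beads E)" unfolding that(3) by (rule symmetric_set_image[OF that(4) sym])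
    ultimately show "E \<in> sc_cores ?N" using that(1) self_conjugate_iff by (auto simp: sc_cores_def)
    show "beads D = u ` beads E" unfolding that(3) image_comp that(5) by simp
  qed (use that in blast)+
  consider "i = 0" | "i = n" | "1 \<le> i" "i < n" using i by linarith
  then show ?thesis
  proof cases
    case 1
    have c0: "int ?N dvd c - int 0" using c(1) 1 by simp
    show ?thesis
      using finish[OF _ _ _ signed_affine_simple_refl_zero[OF n1] simple_refl_zero_involution[OF n1]]
        removal_step[OF core N _ c0 c(2,3)] n1 by simp
  next
    case 2
    have cn: "int ?N dvd c - int n" using c(1) 2 by simp
    have e: "simple_refl_B n n = simple_refl ?N n" using n by (simp add: simple_refl_B_def)
    have nN: "n < ?N" using n by simp
    note F = removal_step[OF core N nN cn c(2,3)]
    have "simple_refl_B n n = simple_refl ?N 0 \<or> (\<exists>i\<in>{1..n}. simple_refl_B n n = simple_refl_B n i)"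
      using n1 by (intro disjI2 bexI[of _ n]) simp_all
    then show ?thesis
      by (rule finish[OF F(1,3) F(2)[folded e] simple_refl_B_signed_affine[OF n order_refl]])
  next
    case 3
    let ?j = "2 * n - i"
    have j: "?j < ?N" "int ?j = ?M - int i" using 3 by (simp_all add: of_nat_diff)
    have neg: "- c + 1 \<in> beads D" "- c \<notin> beads D"
      using sym[unfolded symmetric_set_def, rule_format, of c]
        sym[unfolded symmetric_set_def, rule_format, of "c + 1"] c(2,3)
      by (simp_all add: algebra_simps)
    have cj: "int ?N dvd - c - int ?j"
    proof -
      have "- c - int ?j = - (c - int i) - ?M" using j(2) by simp
      then show ?thesis using c(1) by (metis dvd_diff dvd_minus_iff dvd_refl of_nat_mult of_nat_numeral)
    qed
    define E where "E = core_reflection ?N ?j D"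
    have E: "E \<in> cores ?N" "beads E = simple_refl ?N ?j ` beads D" "card E < card D"
      unfolding E_def by (rule removal_step[OF core N j(1) cj neg])+
    have shift: "int ?N dvd x - int ?j \<longleftrightarrow> ?M dvd x + int i" for x
    proof -
      have "x + int i = (x - int ?j) + ?M" using j(2) by linarith
      then show ?thesis
        using dvd_add_triv_right_iff[of ?M "x - int ?j"] by (simp only: of_nat_mult of_nat_numeral)
    qed
    have excl: "\<not> ?M dvd x + int i" if "\<not> ?M dvd (x + int i) - (c - int i)" for x
      using that c(1) by (meson dvd_diff)
    have n2: "\<not> ?M dvd 2 * int i" using 3 by (intro small_not_dvd) auto
    have fixed: "simple_refl ?N ?j c = c" "simple_refl ?N ?j (c + 1) = c + 1"
    proof -
      have x1: "\<not> ?M dvd c + int i" using excl[of c] n2 by simp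
      have x2: "\<not> ?M dvd c + 1 + int i"
        using excl[of "c + 1"] not_even_dvd_odd(1)[of n "int i"] by (simp add: algebra_simps)
      have x3: "\<not> ?M dvd c - 1 + int i"
        using excl[of "c - 1"] not_even_dvd_odd(2)[of n "int i"] by (simp add: algebra_simps)
      show "simple_refl ?N ?j c = c" using x1 x3 by (intro simple_refl_fixes) (simp_all only: shift not_False_eq_True)
      have "c + 1 - 1 = c" by simp
      then show "simple_refl ?N ?j (c + 1) = c + 1" using x1 x2 by (intro simple_refl_fixes) (simp_all only: shift not_False_eq_True)
    qed
    have cE: "c + 1 \<in> beads E" "c \<notin> beads E"
      unfolding E(2) simple_refl_image[OF N] fixed using c(2,3) by blast+
    have ci: "int ?N dvd c - int i" "i < ?N" using c(1) 3 by simp_all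
    note F = removal_step[OF E(1) N ci(2,1) cE]
    have e: "simple_refl ?N i ` beads E = simple_refl_B n i ` beads D"
      unfolding E(2) using 3 by (simp add: simple_refl_B_def image_comp)
    have "card (core_reflection ?N i E) < card D" using F(3) E(3) by simp
    moreover have "simple_refl_B n i = simple_refl ?N 0 \<or> (\<exists>k\<in>{1..n}. simple_refl_B n i = simple_refl_B n k)"
      using 3 by (intro disjI2 bexI[of _ i]) simp_all
    ultimately show ?thesis
      by (rule finish[OF F(1) _ F(2)[unfolded e] simple_refl_B_signed_affine[OF n i]])
  qed
qed

text \<open>
By induction on the size, a self-conjugate core is obtained from \<open>{..0}\<close> by generators of type B and by
\<open>s\<^sub>0\<close>. Each new \<open>s\<^sub>0\<close> is moved past the word to the right, where it cancels against an earlier one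
if there is one.
\<close>

lemma self_conjugate_core_reached:
  assumes n: "n \<ge> 2" and "D \<in> sc_cores (2 * n)"
  shows "\<exists>is. set is \<subseteq> {0..n} \<and> (beads D = word_prod (simple_refl_B n) is ` {..0} \<or>
    beads D = word_prod (simple_refl_B n) is ` (simple_refl (2 * n) 0 ` {..0}))"
  using assms(2)
proof (induction "card D" arbitrary: D rule: less_induct)
  case less
  let ?s = "simple_refl (2 * n) 0" and ?W = "word_prod (simple_refl_B n)"
  show ?case
  proof (cases "D = {}")
    case True
    then show ?thesis by (intro exI[of _ "[]"]) (simp add: beads_empty)
  next
    case False
    obtain E u where E: "E \<in> sc_cores (2 * n)" "card E < card D" "beads D = u ` beads E"
      and u: "u = ?s \<or> (\<exists>i\<in>{1..n}. u = simple_refl_B n i)"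
      using generator_removal[OF n less.prems False] by blast
    obtain "is" Z where "is": "set is \<subseteq> {0..n}" "beads E = ?W is ` Z" and Z: "Z = {..0} \<or> Z = ?s ` {..0}"
      using less.hyps[OF E(2,1)] by blast
    from u show ?thesis
    proof
      assume u: "u = ?s"
      obtain js where js: "set js \<subseteq> {0..n}" "?s \<circ> ?W is = ?W js \<circ> ?s"
        using simple_refl_zero_past_word[OF n "is"(1)] by blast
      have "beads D = (?s \<circ> ?W is) ` Z" unfolding E(3) "is"(2) u by (simp add: image_comp)
      then have bD: "beads D = ?W js ` (?s ` Z)" unfolding js(2) by (simp add: image_comp)
      have "?s ` (?s ` {..0}) = {..0}"
        unfolding image_comp using simple_refl_zero_involution[of n] n by simp
      then have "beads D = ?W js ` {..0} \<or> beads D = ?W js ` (?s ` {..0})"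
        using Z bD by auto
      then show ?thesis using js(1) by blast
    next
      assume "\<exists>i\<in>{1..n}. u = simple_refl_B n i"
      then obtain i where i: "i \<in> {1..n}" "u = simple_refl_B n i" by blast
      have "beads D = ?W (i # is) ` Z" unfolding E(3) "is"(2) i(2) by (simp add: image_comp)
      then show ?thesis using Z "is"(1) i(1) by (intro exI[of _ "i # is"]) auto
    qed
  qed
qed

lemma even_core_reached:
  assumes n: "n \<ge> 3" and D: "D \<in> sc_even_cores (2 * n)"
  shows "\<exists>is. set is \<subseteq> {0..n} \<and> beads D = word_prod (simple_refl_B n) is ` {..0}"
proof -
  let ?s = "simple_refl (2 * n) 0" and ?W = "word_prod (simple_refl_B n)"
  have n2: "2 \<le> n" and n1: "1 \<le> n" using n by simp_all
  have D': "D \<in> sc_cores (2 * n)" and Y: "young_diagram D"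
    using D by (auto simp: sc_even_cores_def sc_cores_def cores_def)
  have even: "even (card (beads D \<inter> {1..}))"
    using D card_diagonal[OF Y] by (simp add: sc_even_cores_def)
  have "beads D \<noteq> ?W is ` (?s ` {..0})" if "is": "set is \<subseteq> {0..n}" for "is"
  proof
    assume e: "beads D = ?W is ` (?s ` {..0})"
    have "?s ` {..0} \<inter> {1..} = {1}"
    proof
      show "{1} \<subseteq> ?s ` {..0} \<inter> {1..}"
        using simple_refl_zero_values(1)[OF n2] by (auto simp: image_iff intro!: bexI[of _ 0])
      have "?s k \<le> k + 1" for k by (simp add: simple_refl_def)
      moreover have "?s k \<le> 0" if "k \<le> -1" for k using calculation[of k] that by linarith
      ultimately show "?s ` {..0} \<inter> {1..} \<subseteq> {1}" by force
    qed
    then have "odd (card (?s ` {..0} \<inter> {1..}))" "finite (?s ` {..0} \<inter> {1..})" by simp_all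
    then have "odd (card (beads D \<inter> {1..}))"
      unfolding e using parity_word[OF n "is"]
        symmetric_set_image[OF signed_affine_simple_refl_zero[OF n1] symmetric_set_atMost] by blast
    then show False using even by blast
  qed
  then show ?thesis using self_conjugate_core_reached[OF n2 D'] by blast
qed

section \<open>The orbit of the empty core\<close>

lemma weyl_B_affine_words:
  assumes "n \<ge> 2"
  shows "weyl_B_affine n = {word_prod (simple_refl_B n) is | is. set is \<subseteq> {0..n}}"
  unfolding weyl_B_affine_def by (rule generate_eq_words[OF assms order_refl])

lemma weyl_B_finite_words:
  assumes "n \<ge> 2"
  shows "weyl_B_finite n = {word_prod (simple_refl_B n) is | is. set is \<subseteq> {1..n}}"
  unfolding weyl_B_finite_def by (rule generate_eq_words[OF assms]) auto

lemma weyl_B_affine_signed: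
  assumes "n \<ge> 2" "w \<in> weyl_B_affine n"
  shows "signed_affine n w"
  using assms(2) signed_affine_word[OF assms(1)] unfolding weyl_B_affine_words[OF assms(1)] by blast

lemma weyl_B_affine_comp:
  assumes "n \<ge> 2" "v \<in> weyl_B_affine n" "w \<in> weyl_B_affine n"
  shows "v \<circ> w \<in> weyl_B_affine n"
  using generate.eng[of v "affine_sym (2 * n)" _ w] assms(2,3)
  by (simp add: weyl_B_affine_def affine_sym_simps del: comp_apply)

lemma weyl_B_finite_comp:
  assumes "v \<in> weyl_B_finite n" "w \<in> weyl_B_finite n"
  shows "v \<circ> w \<in> weyl_B_finite n"
  using generate.eng[of v "affine_sym (2 * n)" _ w] assms
  by (simp add: weyl_B_finite_def affine_sym_simps del: comp_apply)

lemma weyl_B_finite_subset: "n \<ge> 2 \<Longrightarrow> weyl_B_finite n \<subseteq> weyl_B_affine n"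
  by (auto simp: weyl_B_affine_words weyl_B_finite_words)
    (metis Suc_le_D atLeastAtMost_iff order_trans subset_iff zero_le)

lemma core_action_weyl_B:
  assumes "n \<ge> 2" "w \<in> weyl_B_affine n"
  shows "core_action (2 * n) w {} \<in> cores (2 * n)" "beads (core_action (2 * n) w {}) = w ` {..0}"
proof -
  obtain "is" where "is": "set is \<subseteq> {0..n}" "w = word_prod (simple_refl_B n) is"
    using assms(2) unfolding weyl_B_affine_words[OF assms(1)] by blast
  obtain js where js: "set js \<subseteq> {..<2 * n}" "w = word_prod (simple_refl (2 * n)) js"
    using word_prod_B_as_A[OF assms(1) "is"(1)] "is"(2) by metis
  have "2 \<le> 2 * n" using assms(1) by simp
  from core_action_empty[OF js(1) this js(2)]
  show "core_action (2 * n) w {} \<in> cores (2 * n)" "beads (core_action (2 * n) w {}) = w ` {..0}" .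
qed

lemma core_action_eq_iff:
  assumes "n \<ge> 2" "v \<in> weyl_B_affine n" "w \<in> weyl_B_affine n"
  shows "core_action (2 * n) v {} = core_action (2 * n) w {} \<longleftrightarrow> v ` {..0} = w ` {..0}"
  using core_action_weyl_B[OF assms(1,2)] core_action_weyl_B[OF assms(1,3)] beads_inject
  by (metis (no_types, lifting) cores_def mem_Collect_eq)

lemma weyl_B_finite_fixes:
  assumes n: "n \<ge> 2" and w: "w \<in> weyl_B_finite n"
  shows "w ` {..0} = {..0}"
proof -
  have gen: "simple_refl_B n a ` {..0} = {..0}" if "1 \<le> a" "a \<le> n" for a
  proof (intro Set.set_eqI)
    fix k
    show "k \<in> simple_refl_B n a ` {..0} \<longleftrightarrow> k \<in> {..0}"
      unfolding simple_refl_B_image[OF n that(2)]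
      using simple_refl_B_pos_threshold[OF n that, of k] by auto
  qed
  obtain "is" where "is": "set is \<subseteq> {1..n}" "w = word_prod (simple_refl_B n) is"
    using w unfolding weyl_B_finite_words[OF n] by blast
  have "word_prod (simple_refl_B n) is ` {..0} = {..0}"
    using "is"(1)
  proof (induction "is")
    case (Cons a "is")
    have "word_prod (simple_refl_B n) (a # is) ` {..0} =
        simple_refl_B n a ` (word_prod (simple_refl_B n) is ` {..0})"
      by (simp add: image_comp)
    then show ?case using Cons gen[of a] by simp
  qed simp
  then show ?thesis using "is"(2) by simp
qed

lemma orbit_eq_even_cores:
  assumes n: "n \<ge> 3"
  shows "(\<lambda>w. core_action (2 * n) w {}) ` weyl_B_affine n = sc_even_cores (2 * n)"
proof
  have n2: "n \<ge> 2" using n by simp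
  show "(\<lambda>w. core_action (2 * n) w {}) ` weyl_B_affine n \<subseteq> sc_even_cores (2 * n)"
  proof (rule image_subsetI)
    fix w assume w: "w \<in> weyl_B_affine n"
    let ?D = "core_action (2 * n) w {}"
    note D = core_action_weyl_B[OF n2 w]
    have Y: "young_diagram ?D" using D(1) by (simp add: cores_def)
    obtain "is" where "is": "set is \<subseteq> {0..n}" "w = word_prod (simple_refl_B n) is"
      using w unfolding weyl_B_affine_words[OF n2] by blast
    have e: "{..0::int} \<inter> {1..} = {}" by auto
    have "symmetric_set (w ` {..0})" "even (card (w ` {..0} \<inter> {1..}))"
      using parity_word[OF n "is"(1) symmetric_set_atMost] unfolding e "is"(2) by simp_all
    then have "conjugate ?D = ?D" "even (card {b \<in> ?D. content b = 0})"
      unfolding self_conjugate_iff[OF Y] card_diagonal[OF Y] D(2) .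
    then show "?D \<in> sc_even_cores (2 * n)"
      using D(1) by (simp add: sc_even_cores_def sc_cores_def)
  qed
  show "sc_even_cores (2 * n) \<subseteq> (\<lambda>w. core_action (2 * n) w {}) ` weyl_B_affine n"
  proof
    fix D assume D: "D \<in> sc_even_cores (2 * n)"
    obtain "is" where "is": "set is \<subseteq> {0..n}" "beads D = word_prod (simple_refl_B n) is ` {..0}"
      using even_core_reached[OF n D] by blast
    have w: "word_prod (simple_refl_B n) is \<in> weyl_B_affine n"
      unfolding weyl_B_affine_words[OF n2] using "is"(1) by blast
    have "core_action (2 * n) (word_prod (simple_refl_B n) is) {} = D"
      using core_action_weyl_B[OF n2 w] D "is"(2) beads_inject
      by (simp add: sc_even_cores_def sc_cores_def cores_def)
    then show "D \<in> (\<lambda>w. core_action (2 * n) w {}) ` weyl_B_affine n" using w by blast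
  qed
qed

section \<open>Minimal coset representatives\<close>

text \<open>
Otherwise \<open>w \<circ> t\<^sub>i\<close>, where \<open>t\<^sub>i\<close> is the generator of type B, would be a shorter element of the same coset.
\<close>

lemma affine_grassmannian_ascents:
  assumes n: "n \<ge> 3" and w: "w \<in> affine_grassmannian_B n" and i: "1 \<le> i" "i \<le> n"
  shows "w (int i) < w (int i + 1)"
proof (rule ccontr)
  assume no: "\<not> w (int i) < w (int i + 1)"
  have n2: "n \<ge> 2" using n by simp
  have wB: "w \<in> weyl_B_affine n" and min: "\<And>u. u \<in> w <#\<^bsub>affine_sym (2*n)\<^esub> weyl_B_finite n \<Longrightarrow> length_B n w \<le> length_B n u"
    using w by (auto simp: affine_grassmannian_B_def)
  have "w (int i) \<noteq> w (int i + 1)" by (simp add: signed_affine_inj[OF weyl_B_affine_signed[OF n2 wB]])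
  then have desc: "w (int i + 1) < w (int i)" using no by simp
  obtain "is" where "is": "set is \<subseteq> {0..n}" "w = word_prod (simple_refl_B n) is"
    using wB unfolding weyl_B_affine_words[OF n2] by blast
  have "simple_refl_B n i \<in> weyl_B_finite n"
    unfolding weyl_B_finite_def using i by (intro generate.incl) auto
  then have "w \<circ> simple_refl_B n i \<in> w <#\<^bsub>affine_sym (2*n)\<^esub> weyl_B_finite n"
    unfolding l_coset_def affine_sym_simps by blast
  from min[OF this] descent_shortens[OF n i "is" desc] show False by simp
qed

text \<open>
The symmetry \<open>w (2n + 1 - k) = 2n + 1 - w k\<close> carries the ascents in the first half of the window
over to the second half.
\<close>

lemma ascending_window:
  assumes w: "signed_affine n w" and asc: "\<And>i. 1 \<le> i \<Longrightarrow> i \<le> n \<Longrightarrow> w (int i) < w (int i + 1)"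
    and ab: "1 \<le> a" "a < b" "b \<le> 2 * int n"
  shows "w a < w b"
proof -
  have consecutive: "w k < w (k + 1)" if k: "1 \<le> k" "k < 2 * int n" for k
  proof (cases "k \<le> int n")
    case True
    then show ?thesis using asc[of "nat k"] k by simp
  next
    case False
    define i where "i = 2 * int n - k"
    have i: "1 \<le> i" "i \<le> int n" using k False by (auto simp: i_def)
    have k': "k = 1 - (i + 1) + 2 * int n * 1" "k + 1 = 1 - i + 2 * int n * 1"
      by (simp_all add: i_def)
    have "w k = 1 - w (i + 1) + 2 * int n * 1"
      by (subst k'(1)) (simp only: signed_affine_shift[OF w] signed_affine_reflect[OF w])
    moreover have "w (k + 1) = 1 - w i + 2 * int n * 1"
      by (subst k'(2)) (simp only: signed_affine_shift[OF w] signed_affine_reflect[OF w])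
    moreover have "w i < w (i + 1)" using asc[of "nat i"] i by simp
    ultimately show ?thesis by simp
  qed
  from ab(2,3) show ?thesis
  proof (induction b rule: int_gr_induct)
    case base
    then show ?case using consecutive[of a] ab(1) by simp
  next
    case (step b)
    then show ?case using consecutive[of b] ab(1) by simp
  qed
qed

lemma increasing_enumeration_unique:
  fixes f g :: "int \<Rightarrow> int"
  assumes f: "\<And>a b. 1 \<le> a \<Longrightarrow> a < b \<Longrightarrow> b \<le> m \<Longrightarrow> f a < f b"
    and g: "\<And>a b. 1 \<le> a \<Longrightarrow> a < b \<Longrightarrow> b \<le> m \<Longrightarrow> g a < g b"
    and im: "f ` {1..m} = g ` {1..m}"
  shows "1 \<le> k \<Longrightarrow> k \<le> m \<Longrightarrow> f k = g k"
proof (induction "nat k" arbitrary: k rule: less_induct)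
  case less
  have IH: "f j = g j" if "1 \<le> j" "j < k" for j
    using less.hyps[of j] that less.prems by simp
  have "f k \<in> g ` {1..m}" unfolding im[symmetric] using less.prems by (intro imageI) simp
  then obtain j where "f k = g j" "j \<in> {1..m}" by (rule imageE)
  then have j: "1 \<le> j" "j \<le> m" "f k = g j" by simp_all
  have "g k \<in> f ` {1..m}" unfolding im using less.prems by (intro imageI) simp
  then obtain l where "g k = f l" "l \<in> {1..m}" by (rule imageE)
  then have l: "1 \<le> l" "l \<le> m" "g k = f l" by simp_all
  have "k \<le> j"
  proof (rule leI, rule notI)
    assume "j < k"
    then show False using IH[OF j(1)] f[OF j(1) _ less.prems(2)] j(3) by simp
  qed
  moreover have "k \<le> l"
  proof (rule leI, rule notI)
    assume "l < k"
    then show False using IH[OF l(1)] g[OF l(1) _ less.prems(2)] l(3) by simp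
  qed
  ultimately have "g k \<le> g j" "f k \<le> f l"
    using g[OF less.prems(1) _ j(2)] f[OF less.prems(1) _ l(2)] by (auto simp: le_less)
  then show ?case using j(3) l(3) by simp
qed

text \<open>
The image of the window \<open>{1..2n}\<close> is the difference of the bead set translated by \<open>2n\<close> and the bead
set itself; an increasing \<open>w\<close> is the increasing enumeration of this image.
\<close>

lemma affine_grassmannian_determined:
  assumes n: "n \<ge> 3" and v: "v \<in> affine_grassmannian_B n" and w: "w \<in> affine_grassmannian_B n"
    and eq: "v ` {..0} = w ` {..0}"
  shows "v = w"
proof
  fix k
  let ?M = "2 * int n"
  have n2: "n \<ge> 2" using n by simp
  have sv: "signed_affine n v" and sw: "signed_affine n w"
    using v w weyl_B_affine_signed[OF n2] by (auto simp: affine_grassmannian_B_def)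
  have window: "u ` {1..?M} = (\<lambda>x. x + ?M) ` (u ` {..0}) - u ` {..0}" if u: "signed_affine n u" for u
  proof -
    have "(\<lambda>x. x + ?M) ` (u ` {..0}) = u ` ((\<lambda>x. x + ?M) ` {..0})"
      using u unfolding image_image by (simp add: signed_affine_def)
    also have "(\<lambda>x. x + ?M) ` {..0} = {..?M}"
      by (auto simp: image_iff intro!: bexI[of _ "_ - ?M"])
    finally have e: "(\<lambda>x. x + ?M) ` (u ` {..0}) = u ` {..?M}" .
    have "inj u" using u by (simp add: signed_affine_def bij_is_inj)
    then have "u ` {..?M} - u ` {..0} = u ` ({..?M} - {..0})" by (rule image_set_diff[symmetric])
    also have "{..?M} - {..0} = {1..?M}" by auto
    finally show ?thesis unfolding e by simp
  qed
  have im: "v ` {1..?M} = w ` {1..?M}" unfolding window[OF sv] window[OF sw] eq ..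
  have agree: "v j = w j" if "1 \<le> j" "j \<le> ?M" for j
    using that
    by (rule increasing_enumeration_unique[where m = ?M, rotated 3])
      (use im ascending_window[OF sv affine_grassmannian_ascents[OF n v]]
        ascending_window[OF sw affine_grassmannian_ascents[OF n w]] in blast)+
  \<comment> \<open>The shift by one makes the representative \<open>r\<close> lie in \<open>{1..2n}\<close>.\<close>
  define q r where "q = (k - 1) div ?M" and "r = (k - 1) mod ?M + 1"
  have k: "k = r + ?M * q"
    unfolding q_def r_def using mult_div_mod_eq[of ?M "k - 1"] by linarith
  have "1 \<le> r" "r \<le> ?M"
    unfolding r_def using n pos_mod_sign[of ?M "k - 1"] pos_mod_bound[of ?M "k - 1"] by linarith+
  then show "v k = w k"
    unfolding k signed_affine_shift[OF sv] signed_affine_shift[OF sw] using agree by simp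
qed

text \<open>
A shortest element of the coset of \<open>v\<close> has the same image of \<open>{..0}\<close>, because the finite group
preserves this set.
\<close>

lemma affine_grassmannian_representative:
  assumes n: "n \<ge> 2" and v: "v \<in> weyl_B_affine n"
  shows "\<exists>w\<in>affine_grassmannian_B n. w ` {..0} = v ` {..0}"
proof -
  let ?C = "(\<lambda>h. v \<circ> h) ` weyl_B_finite n"
  have "id \<in> weyl_B_finite n"
    using generate.one[of "affine_sym (2 * n)"] unfolding weyl_B_finite_def affine_sym_simps .
  then have "\<exists>w. w \<in> ?C" by blast
  from exists_least_iff[of "\<lambda>l. \<exists>w\<in>?C. length_B n w = l"] this
  obtain w where w: "w \<in> ?C" and min: "\<And>u. u \<in> ?C \<Longrightarrow> length_B n w \<le> length_B n u"
    by (metis not_less)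
  obtain h where h: "h \<in> weyl_B_finite n" "w = v \<circ> h" using w by blast
  have "h \<in> weyl_B_affine n" using h(1) weyl_B_finite_subset[OF n] by blast
  then have wB: "w \<in> weyl_B_affine n" unfolding h(2) by (rule weyl_B_affine_comp[OF n v])
  have "u \<in> ?C" if u: "u \<in> w <#\<^bsub>affine_sym (2*n)\<^esub> weyl_B_finite n" for u
  proof -
    obtain h' where h': "h' \<in> weyl_B_finite n" "u = w \<circ> h'"
      using u unfolding l_coset_def affine_sym_simps by blast
    have "u = v \<circ> (h \<circ> h')" unfolding h'(2) h(2) by (rule comp_assoc)
    then show ?thesis using weyl_B_finite_comp[OF h(1) h'(1)] by blast
  qed
  then have "w \<in> affine_grassmannian_B n"
    unfolding affine_grassmannian_B_def using wB min by blast
  moreover have "w ` {..0} = v ` {..0}"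
    unfolding h(2) image_comp[symmetric] weyl_B_finite_fixes[OF n h(1)] ..
  ultimately show ?thesis by blast
qed

theorem lemma5p8:
  fixes n :: nat
  assumes "n \<ge> 3"
  shows "orbit (affine_sym (2*n) \<lparr>carrier := weyl_B_affine n\<rparr>) (core_action (2*n)) {}
           = sc_even_cores (2*n)
         \<and> bij_betw (\<lambda>w. core_action (2*n) w {}) (affine_grassmannian_B n) (sc_even_cores (2*n))"
proof
  have n2: "n \<ge> 2" using assms by simp
  have sub: "affine_grassmannian_B n \<subseteq> weyl_B_affine n" by (auto simp: affine_grassmannian_B_def)
  show "orbit (affine_sym (2*n) \<lparr>carrier := weyl_B_affine n\<rparr>) (core_action (2*n)) {} = sc_even_cores (2*n)"
    unfolding orbit_eq_even_cores[OF assms, symmetric] orbit_def by auto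
  show "bij_betw (\<lambda>w. core_action (2*n) w {}) (affine_grassmannian_B n) (sc_even_cores (2*n))"
    unfolding bij_betw_def
  proof
    show "inj_on (\<lambda>w. core_action (2*n) w {}) (affine_grassmannian_B n)"
    proof (rule inj_onI)
      fix v w assume vw: "v \<in> affine_grassmannian_B n" "w \<in> affine_grassmannian_B n"
        "core_action (2*n) v {} = core_action (2*n) w {}"
      then have "v ` {..0} = w ` {..0}" using core_action_eq_iff[OF n2, of v w] sub by blast
      then show "v = w" by (rule affine_grassmannian_determined[OF assms vw(1,2)])
    qed
    have "(\<lambda>w. core_action (2*n) w {}) ` affine_grassmannian_B n = (\<lambda>w. core_action (2*n) w {}) ` weyl_B_affine n"
    proof
      show "(\<lambda>w. core_action (2*n) w {}) ` weyl_B_affine n \<subseteq> (\<lambda>w. core_action (2*n) w {}) ` affine_grassmannian_B n"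
      proof (rule image_subsetI)
        fix v assume v: "v \<in> weyl_B_affine n"
        obtain w where w: "w \<in> affine_grassmannian_B n" "w ` {..0} = v ` {..0}"
          using affine_grassmannian_representative[OF n2 v] by blast
        then have "core_action (2*n) v {} = core_action (2*n) w {}"
          using core_action_eq_iff[OF n2 v, of w] sub by blast
        then show "core_action (2*n) v {} \<in> (\<lambda>w. core_action (2*n) w {}) ` affine_grassmannian_B n"
          using w(1) by (rule image_eqI)
      qed
    qed (use sub in blast)
    then show "(\<lambda>w. core_action (2*n) w {}) ` affine_grassmannian_B n = sc_even_cores (2*n)"
      unfolding orbit_eq_even_cores[OF assms] .
  qed
qed

end
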